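(* Let $n \in \mathbb{N}$ with $n\ge 3$, and let $\delta, \epsilon \in (0, 2^{-4})$. Let $T$ be any estimator, with sample counts $\{N_{\{i,j,k\}}\}$, such that $$N_{i^*, j^*} \leq \epsilon^{-2}\log(1/\delta)/4 \quad \text{for some } i^* \neq j^* \in [n].$$ Then there exist two choice models $(\mathbf{0}, \Sigma^1)$ and $(\mathbf{0}, \Sigma^2)$, with $\Sigma^1,\Sigma^2$ normalized, such that $$\operatorname{Tr}(\Sigma^1) = \operatorname{Tr}(\Sigma^2) = n \quad\text{and}\quad \|\Sigma^1 - \Sigma^2\|_\infty \geq \epsilon,$$ and $$\max_{\Sigma \in \{\Sigma^1, \Sigma^2\}} \Pr_{\mathbf{X} \sim (T, \mathrm{Choice}(\mathbf{0}, \Sigma))}\left\{\|T(\mathbf{X}) - \Sigma\|_\infty \geq \frac{\epsilon}{4}\right\} \geq \delta.$$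
   Context: For $\mu\in\mathbb{R}^n$ and $\Sigma\in\mathbb{R}^{n\times n}$ symmetric positive semidefinite, $\mathrm{Choice}(\mu,\Sigma)$ is the probit choice model with utilities $X\sim\mathcal{N}(\mu,\Sigma)$. Parameters are normalized as follows: $\langle \mu,\mathbf{1}\rangle=0$, $\Sigma\mathbf{1}=0$, $\operatorname{Tr}(\Sigma)=n$, and $\operatorname{rank}(\Sigma)=n-1$. An estimator $T$ is specified by nonnegative integers $N_{\{i,j,k\}}$, one for each 3-element subset $\{i,j,k\}\subseteq[n]$. For each such triple, independently, it obtains $N_{\{i,j,k\}}$ samples of the ordering of $(X_i,X_j,X_k)$, where each sample uses a fresh $X\sim\mathcal{N}(\mu,\Sigma)$. It then outputs an estimate $T(\mathbf{X})$ of $\Sigma$ from all collected samples $\mathbf{X}$. For distinct $i,j$, define $N_{i,j} := \sum_{k\notin\{i,j\}} N_{\{i,j,k\}}$. $\|\cdot\|_\infty$ denotes the entrywise maximum absolute value. *)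

theory Defs
  imports "HOL-Probability.Probability" "Jordan_Normal_Form.DL_Rank"
begin

text \<open>Conventions: the index set is [n] = {0..<n}; vectors in R^n are functions
  nat => real (only entries below n matter); n x n matrices are functions
  nat => nat => real (only entries below n matter).\<close>

definition to_mat :: "nat \<Rightarrow> (nat \<Rightarrow> nat \<Rightarrow> real) \<Rightarrow> real mat" where
  "to_mat n A = mat n n (\<lambda>(i, j). A i j)"

definition mat_rank :: "nat \<Rightarrow> (nat \<Rightarrow> nat \<Rightarrow> real) \<Rightarrow> nat" where
  "mat_rank n A = vec_space.rank n (to_mat n A)"

definition mat_trace :: "nat \<Rightarrow> (nat \<Rightarrow> nat \<Rightarrow> real) \<Rightarrow> real" where
  "mat_trace n A = (\<Sum>i<n. A i i)"

definition sym_psd :: "nat \<Rightarrow> (nat \<Rightarrow> nat \<Rightarrow> real) \<Rightarrow> bool" where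
  "sym_psd n A \<longleftrightarrow> (\<forall>i<n. \<forall>j<n. A i j = A j i) \<and>
     (\<forall>x :: nat \<Rightarrow> real. (\<Sum>i<n. \<Sum>j<n. x i * A i j * x j) \<ge> 0)"

definition normalized_cov :: "nat \<Rightarrow> (nat \<Rightarrow> nat \<Rightarrow> real) \<Rightarrow> bool" where
  "normalized_cov n S \<longleftrightarrow> sym_psd n S \<and> (\<forall>i<n. (\<Sum>j<n. S i j) = 0) \<and>
     mat_trace n S = real n \<and> mat_rank n S = n - 1"

definition max_norm :: "nat \<Rightarrow> (nat \<Rightarrow> nat \<Rightarrow> real) \<Rightarrow> real" where
  "max_norm n A = Max {\<bar>A i j\<bar> | i j. i < n \<and> j < n}"

definition std_gauss :: "nat \<Rightarrow> (nat \<Rightarrow> real) measure" where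
  "std_gauss n = PiM {0..<n} (\<lambda>_. density lborel std_normal_density)"

definition sqrt_factor :: "nat \<Rightarrow> (nat \<Rightarrow> nat \<Rightarrow> real) \<Rightarrow> (nat \<Rightarrow> nat \<Rightarrow> real)" where
  "sqrt_factor n S = (SOME A. \<forall>i<n. \<forall>j<n. (\<Sum>k<n. A i k * A j k) = S i j)"

text \<open>The Gaussian N(mu, Sigma) on [n], realised as mu + A Z with Z standard and
  A A^T = Sigma (its law does not depend on the choice of A).\<close>
definition gauss :: "nat \<Rightarrow> (nat \<Rightarrow> real) \<Rightarrow> (nat \<Rightarrow> nat \<Rightarrow> real) \<Rightarrow> (nat \<Rightarrow> real) measure" where
  "gauss n mu S = distr (std_gauss n) (PiM {0..<n} (\<lambda>_. borel))
     (\<lambda>Z. \<lambda>i\<in>{0..<n}. mu i + (\<Sum>k<n. sqrt_factor n S i k * Z k))"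

definition ordering :: "(nat \<Rightarrow> real) \<Rightarrow> nat set \<Rightarrow> nat list" where
  "ordering X t = sort_key X (sorted_list_of_set t)"

definition choice_order :: "nat \<Rightarrow> (nat \<Rightarrow> real) \<Rightarrow> (nat \<Rightarrow> nat \<Rightarrow> real) \<Rightarrow> nat set \<Rightarrow> nat list measure" where
  "choice_order n mu S t = distr (gauss n mu S) (count_space UNIV) (\<lambda>X. ordering X t)"

definition triples :: "nat \<Rightarrow> nat set set" where
  "triples n = {t. t \<subseteq> {0..<n} \<and> card t = 3}"

definition sample_index :: "nat \<Rightarrow> (nat set \<Rightarrow> nat) \<Rightarrow> (nat set \<times> nat) set" where
  "sample_index n N = {(t, m). t \<in> triples n \<and> m < N t}"

definition sample_law :: "nat \<Rightarrow> (nat set \<Rightarrow> nat) \<Rightarrow> (nat \<Rightarrow> real) \<Rightarrow> (nat \<Rightarrow> nat \<Rightarrow> real)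
    \<Rightarrow> (nat set \<times> nat \<Rightarrow> nat list) measure" where
  "sample_law n N mu S = PiM (sample_index n N) (\<lambda>(t, m). choice_order n mu S t)"

definition pair_count :: "nat \<Rightarrow> (nat set \<Rightarrow> nat) \<Rightarrow> nat \<Rightarrow> nat \<Rightarrow> nat" where
  "pair_count n N i j = (\<Sum>k\<in>{0..<n} - {i, j}. N {i, j, k})"

end

theory Submission
  imports Defs
begin

text \<open>
  Give the coordinates \<open>i\<close> and \<open>j\<close> of a standard Gaussian vector correlation \<open>t\<close>, then center and
  rescale. Orderings depend on the covariance only through the variances of differences, up to a
  common factor, and only the variance of \<open>X\<^sub>i - X\<^sub>j\<close> depends on \<open>t\<close>; so only the triples containing
  both \<open>i\<close> and \<open>j\<close> carry information about \<open>t\<close>. For such a triple \<open>{i, j, k}\<close> the combinations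
  \<open>X\<^sub>i + X\<^sub>j - 2 X\<^sub>k\<close> and \<open>X\<^sub>i - X\<^sub>j\<close> are independent, and the ordering is a function of them in which
  only the ratio of the two standard deviations matters. The comparison of \<open>t = 0\<close> with
  \<open>t = 3\<epsilon>/2\<close> thus reduces to two centered normal laws on the line whose scales have ratio \<open>\<rho>\<close>, with
  Hellinger affinity \<open>sqrt (2\<rho> / (1 + \<rho>\<^sup>2)) \<ge> exp (- \<epsilon>\<^sup>2)\<close>. Affinities multiply over independent
  samples, and Le Cam's two-point inequality gives the claim.
\<close>

section \<open>Linear forms of standard Gaussian vectors\<close>

definition std_normal :: "real measure" where
  "std_normal = density lborel std_normal_density"

lemma sets_std_normal [measurable_cong]: "sets std_normal = sets borel"
  by (simp add: std_normal_def)

lemma space_std_normal [simp]: "space std_normal = UNIV"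
  by (simp add: std_normal_def)

lemma prob_space_std_normal: "prob_space std_normal"
  unfolding std_normal_def by (rule prob_space_normal_density) simp

interpretation std_normal: prob_space std_normal
  by (rule prob_space_std_normal)

interpretation std_normal_pair: pair_prob_space std_normal std_normal ..

section \<open>Rotation invariance of the planar standard normal law\<close>

text \<open>For fixed \<open>y\<close> the shear is a translation in \<open>x\<close>; Fubini moves
  the \<open>x\<close> integral inside, where translation invariance applies.\<close>

lemma lborel_shear_fst:
  fixes f :: "real \<times> real \<Rightarrow> ennreal"
  assumes [measurable]: "f \<in> borel_measurable (borel \<Otimes>\<^sub>M borel)"
  shows "(\<integral>\<^sup>+x. \<integral>\<^sup>+y. f (x + c * y, y) \<partial>lborel \<partial>lborel) = (\<integral>\<^sup>+x. \<integral>\<^sup>+y. f (x, y) \<partial>lborel \<partial>lborel)"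
proof -
  have "(\<integral>\<^sup>+x. \<integral>\<^sup>+y. f (x + c * y, y) \<partial>lborel \<partial>lborel) = (\<integral>\<^sup>+y. \<integral>\<^sup>+x. f (x + c * y, y) \<partial>lborel \<partial>lborel)"
    by (rule lborel_pair.Fubini') measurable
  also have "\<dots> = (\<integral>\<^sup>+y. \<integral>\<^sup>+x. f (x, y) \<partial>lborel \<partial>lborel)"
  proof (rule nn_integral_cong)
    fix y :: real
    show "(\<integral>\<^sup>+x. f (x + c * y, y) \<partial>lborel) = (\<integral>\<^sup>+x. f (x, y) \<partial>lborel)"
      using nn_integral_real_affine[of "\<lambda>x. f (x, y)" 1 "c * y"] by (simp add: add.commute)
  qed
  also have "\<dots> = (\<integral>\<^sup>+x. \<integral>\<^sup>+y. f (x, y) \<partial>lborel \<partial>lborel)"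
    by (rule lborel_pair.Fubini') measurable
  finally show ?thesis .
qed

lemma lborel_shear_snd:
  fixes f :: "real \<times> real \<Rightarrow> ennreal"
  assumes [measurable]: "f \<in> borel_measurable (borel \<Otimes>\<^sub>M borel)"
  shows "(\<integral>\<^sup>+x. \<integral>\<^sup>+y. f (x, y + c * x) \<partial>lborel \<partial>lborel) = (\<integral>\<^sup>+x. \<integral>\<^sup>+y. f (x, y) \<partial>lborel \<partial>lborel)"
proof (rule nn_integral_cong)
  fix x :: real
  show "(\<integral>\<^sup>+y. f (x, y + c * x) \<partial>lborel) = (\<integral>\<^sup>+y. f (x, y) \<partial>lborel)"
    using nn_integral_real_affine[of "\<lambda>y. f (x, y)" 1 "c * x"] by (simp add: add.commute)
qed

text \<open>A rotation by an angle \<open>\<theta>\<close> other than \<open>\<pi>\<close> is a product of three shears, with slopes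
  \<open>- tan (\<theta>/2)\<close>, \<open>sin \<theta>\<close> and \<open>- tan (\<theta>/2)\<close>.\<close>

lemma lborel_rotation:
  fixes f :: "real \<times> real \<Rightarrow> ennreal"
  assumes [measurable]: "f \<in> borel_measurable (borel \<Otimes>\<^sub>M borel)"
    and "\<alpha> \<ge> 0" and unit: "\<alpha>\<^sup>2 + \<beta>\<^sup>2 = 1"
  shows "(\<integral>\<^sup>+x. \<integral>\<^sup>+y. f (\<alpha> * x - \<beta> * y, \<beta> * x + \<alpha> * y) \<partial>lborel \<partial>lborel) =
         (\<integral>\<^sup>+x. \<integral>\<^sup>+y. f (x, y) \<partial>lborel \<partial>lborel)"
proof -
  \<comment> \<open>With \<open>\<alpha>\<close> and \<open>\<beta>\<close> the cosine and sine of
    the angle, this is the tangent of the half angle; \<open>\<alpha> \<ge> 0\<close> keeps the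
    denominator positive.\<close>
  define \<tau> where "\<tau> = \<beta> / (1 + \<alpha>)"
  have \<tau>: "\<tau> * (1 + \<alpha>) = \<beta>"
    using \<open>\<alpha> \<ge> 0\<close> by (simp add: \<tau>_def)
  have "\<tau> * \<beta> * (1 + \<alpha>) = (1 - \<alpha>) * (1 + \<alpha>)"
    using \<tau> unit by (simp add: algebra_simps power2_eq_square flip: distrib_left)
  then have \<tau>\<beta>: "1 - \<tau> * \<beta> = \<alpha>"
    using \<open>\<alpha> \<ge> 0\<close> by simp
  define f1 where "f1 = (\<lambda>(x, y). f (x + (-\<tau>) * y, y))"
  define f2 where "f2 = (\<lambda>(x, y). f1 (x, y + \<beta> * x))"
  have m1[measurable]: "f1 \<in> borel_measurable (borel \<Otimes>\<^sub>M borel)"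
    unfolding f1_def by measurable
  have m2[measurable]: "f2 \<in> borel_measurable (borel \<Otimes>\<^sub>M borel)"
    unfolding f2_def by measurable
  have "f (\<alpha> * x - \<beta> * y, \<beta> * x + \<alpha> * y) = f2 (x + (-\<tau>) * y, y)" for x y
  proof -
    have 1: "\<beta> * x + \<alpha> * y = y + \<beta> * (x + (-\<tau>) * y)"
      by (simp add: algebra_simps flip: \<tau>\<beta>)
    have "\<alpha> * x - \<beta> * y = (1 - \<tau> * \<beta>) * x - \<tau> * (1 + (1 - \<tau> * \<beta>)) * y"
      by (simp only: \<tau> \<tau>\<beta>)
    then have "\<alpha> * x - \<beta> * y = (x + (-\<tau>) * y) + (-\<tau>) * (y + \<beta> * (x + (-\<tau>) * y))"
      by (simp add: algebra_simps)
    with 1 show ?thesis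
      by (simp add: f2_def f1_def)
  qed
  then have "(\<integral>\<^sup>+x. \<integral>\<^sup>+y. f (\<alpha> * x - \<beta> * y, \<beta> * x + \<alpha> * y) \<partial>lborel \<partial>lborel) =
      (\<integral>\<^sup>+x. \<integral>\<^sup>+y. f2 (x + (-\<tau>) * y, y) \<partial>lborel \<partial>lborel)"
    by (simp only:)
  also have "\<dots> = (\<integral>\<^sup>+x. \<integral>\<^sup>+y. f2 (x, y) \<partial>lborel \<partial>lborel)"
    by (rule lborel_shear_fst[OF m2])
  also have "\<dots> = (\<integral>\<^sup>+x. \<integral>\<^sup>+y. f1 (x, y + \<beta> * x) \<partial>lborel \<partial>lborel)"
    by (simp only: f2_def prod.case)
  also have "\<dots> = (\<integral>\<^sup>+x. \<integral>\<^sup>+y. f1 (x, y) \<partial>lborel \<partial>lborel)"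
    by (rule lborel_shear_snd[OF m1])
  also have "\<dots> = (\<integral>\<^sup>+x. \<integral>\<^sup>+y. f (x + (-\<tau>) * y, y) \<partial>lborel \<partial>lborel)"
    by (simp only: f1_def prod.case)
  also have "\<dots> = (\<integral>\<^sup>+x. \<integral>\<^sup>+y. f (x, y) \<partial>lborel \<partial>lborel)"
    by (rule lborel_shear_fst) measurable
  finally show ?thesis .
qed

lemma nn_integral_std_normal_pair:
  fixes f :: "real \<times> real \<Rightarrow> ennreal"
  assumes [measurable]: "f \<in> borel_measurable (borel \<Otimes>\<^sub>M borel)"
  shows "(\<integral>\<^sup>+x. \<integral>\<^sup>+y. f (x, y) \<partial>std_normal \<partial>std_normal) =
    (\<integral>\<^sup>+x. \<integral>\<^sup>+y. ennreal (exp (- (x\<^sup>2 + y\<^sup>2) / 2) / (2 * pi)) * f (x, y) \<partial>lborel \<partial>lborel)"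
proof -
  have d: "std_normal_density x * std_normal_density y = exp (- (x\<^sup>2 + y\<^sup>2) / 2) / (2 * pi)" for x y
    by (simp add: std_normal_density_def add_divide_distrib diff_divide_distrib flip: exp_add)
  have "(\<integral>\<^sup>+x. \<integral>\<^sup>+y. f (x, y) \<partial>std_normal \<partial>std_normal) =
      (\<integral>\<^sup>+x. ennreal (std_normal_density x) * (\<integral>\<^sup>+y. ennreal (std_normal_density y) * f (x, y) \<partial>lborel) \<partial>lborel)"
    by (simp add: std_normal_def nn_integral_density)
  also have "\<dots> = (\<integral>\<^sup>+x. \<integral>\<^sup>+y. ennreal (std_normal_density x) * (ennreal (std_normal_density y) * f (x, y)) \<partial>lborel \<partial>lborel)"
    by (subst nn_integral_cmult) auto
  also have "\<dots> = (\<integral>\<^sup>+x. \<integral>\<^sup>+y. ennreal (exp (- (x\<^sup>2 + y\<^sup>2) / 2) / (2 * pi)) * f (x, y) \<partial>lborel \<partial>lborel)"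
    by (simp add: d flip: mult.assoc ennreal_mult)
  finally show ?thesis .
qed

text \<open>The joint density depends only on \<open>x\<^sup>2 + y\<^sup>2\<close>, which a rotation
  preserves, and so does Lebesgue measure transform trivially.\<close>

lemma std_normal_pair_rotation:
  fixes f :: "real \<times> real \<Rightarrow> ennreal"
  assumes [measurable]: "f \<in> borel_measurable (borel \<Otimes>\<^sub>M borel)"
    and "\<alpha> \<ge> 0" and unit: "\<alpha>\<^sup>2 + \<beta>\<^sup>2 = 1"
  shows "(\<integral>\<^sup>+x. \<integral>\<^sup>+y. f (\<alpha> * x - \<beta> * y, \<beta> * x + \<alpha> * y) \<partial>std_normal \<partial>std_normal) =
         (\<integral>\<^sup>+x. \<integral>\<^sup>+y. f (x, y) \<partial>std_normal \<partial>std_normal)"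
proof -
  have sq: "(\<alpha> * x - \<beta> * y)\<^sup>2 + (\<beta> * x + \<alpha> * y)\<^sup>2 = x\<^sup>2 + y\<^sup>2" for x y
  proof -
    have "(\<alpha> * x - \<beta> * y)\<^sup>2 + (\<beta> * x + \<alpha> * y)\<^sup>2 = (\<alpha>\<^sup>2 + \<beta>\<^sup>2) * (x\<^sup>2 + y\<^sup>2)"
      by (simp add: power2_eq_square algebra_simps)
    then show ?thesis using unit by simp
  qed
  define g where "g = (\<lambda>(x, y). ennreal (exp (- (x\<^sup>2 + y\<^sup>2) / 2) / (2 * pi)) * f (x, y))"
  have [measurable]: "g \<in> borel_measurable (borel \<Otimes>\<^sub>M borel)"
    unfolding g_def by measurable
  have "(\<integral>\<^sup>+x. \<integral>\<^sup>+y. f (\<alpha> * x - \<beta> * y, \<beta> * x + \<alpha> * y) \<partial>std_normal \<partial>std_normal) =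
     (\<integral>\<^sup>+x. \<integral>\<^sup>+y. g (\<alpha> * x - \<beta> * y, \<beta> * x + \<alpha> * y) \<partial>lborel \<partial>lborel)"
    using nn_integral_std_normal_pair[of "\<lambda>(x, y). f (\<alpha> * x - \<beta> * y, \<beta> * x + \<alpha> * y)"]
    by (simp add: g_def sq del: minus_add_distrib)
  also have "\<dots> = (\<integral>\<^sup>+x. \<integral>\<^sup>+y. g (x, y) \<partial>lborel \<partial>lborel)"
    by (rule lborel_rotation) (use assms in measurable)
  also have "\<dots> = (\<integral>\<^sup>+x. \<integral>\<^sup>+y. f (x, y) \<partial>std_normal \<partial>std_normal)"
    by (subst nn_integral_std_normal_pair) (simp_all add: g_def)
  finally show ?thesis .
qed

text \<open>Supplies the rotation that turns \<open>a * x + p * z\<close> into a multiple of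
  \<open>x\<close> alone. At the origin every direction would do, and the first unit vector is
  taken.\<close>

lemma polar_coordinates_nonneg:
  fixes a p :: real
  assumes "a \<ge> 0"
  obtains \<alpha> \<beta> where "\<alpha> \<ge> 0" "\<alpha>\<^sup>2 + \<beta>\<^sup>2 = 1" "a = sqrt (a\<^sup>2 + p\<^sup>2) * \<alpha>" "p = sqrt (a\<^sup>2 + p\<^sup>2) * \<beta>"
proof (cases "a\<^sup>2 + p\<^sup>2 = 0")
  case True
  then have "a = 0" "p = 0" by (auto simp: sum_power2_eq_zero_iff)
  then show ?thesis by (intro that[of 1 0]) auto
next
  case False
  then have "a\<^sup>2 + p\<^sup>2 > 0" by (simp add: less_le)
  then show ?thesis
    using assms by (intro that[of "a / sqrt (a\<^sup>2 + p\<^sup>2)" "p / sqrt (a\<^sup>2 + p\<^sup>2)"])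
      (auto simp: power_divide simp flip: add_divide_distrib)
qed

section \<open>Joint law of two linear forms\<close>

lemma measurable_std_gauss_component [measurable]:
  "k < n \<Longrightarrow> (\<lambda>Z. Z k) \<in> borel_measurable (std_gauss n)"
  unfolding std_gauss_def by measurable

lemma std_gauss_Suc_nn_integral:
  fixes f :: "(nat \<Rightarrow> real) \<Rightarrow> ennreal"
  assumes "f \<in> borel_measurable (std_gauss (Suc n))"
  shows "(\<integral>\<^sup>+Z. f Z \<partial>std_gauss (Suc n)) = (\<integral>\<^sup>+Z. \<integral>\<^sup>+z. f (Z(n := z)) \<partial>std_normal \<partial>std_gauss n)"
proof -
  interpret product_prob_space "\<lambda>_::nat. std_normal" "UNIV :: nat set" ..
  have [simp]: "{0..<Suc n} = insert n {0..<n}" by auto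
  show ?thesis
    using assms unfolding std_gauss_def std_normal_def[symmetric]
    by (simp add: product_nn_integral_insert)
qed

text \<open>The numbers \<open>a\<close>, \<open>b\<close>, \<open>c\<close> form the Cholesky factor of the Gram matrix of \<open>u\<close> and \<open>w\<close>; each new
  coordinate is absorbed into them by two plane rotations.\<close>

lemma linear_forms_canonical:
  fixes u w :: "nat \<Rightarrow> real"
  shows "\<exists>a b c. a \<ge> 0 \<and> c \<ge> 0 \<and> a\<^sup>2 = (\<Sum>k<n. (u k)\<^sup>2) \<and> a * b = (\<Sum>k<n. u k * w k) \<and>
    b\<^sup>2 + c\<^sup>2 = (\<Sum>k<n. (w k)\<^sup>2) \<and>
    (\<forall>f::real \<times> real \<Rightarrow> ennreal. f \<in> borel_measurable (borel \<Otimes>\<^sub>M borel) \<longrightarrow>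
      (\<integral>\<^sup>+Z. f (\<Sum>k<n. u k * Z k, \<Sum>k<n. w k * Z k) \<partial>std_gauss n) =
      (\<integral>\<^sup>+x. \<integral>\<^sup>+y. f (a * x, b * x + c * y) \<partial>std_normal \<partial>std_normal))"
proof (induction n)
  case 0
  interpret prob_space "std_gauss 0"
    unfolding std_gauss_def std_normal_def[symmetric]
    by (rule prob_space_PiM) (rule prob_space_std_normal)
  show ?case
    by (rule exI[of _ 0])+ (simp add: emeasure_space_1 std_normal.emeasure_space_1[simplified])
next
  case (Suc n)
  then obtain a b c where nn: "a \<ge> 0" "c \<ge> 0"
    and gram: "a\<^sup>2 = (\<Sum>k<n. (u k)\<^sup>2)" "a * b = (\<Sum>k<n. u k * w k)" "b\<^sup>2 + c\<^sup>2 = (\<Sum>k<n. (w k)\<^sup>2)"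
    and IH: "\<And>f::real \<times> real \<Rightarrow> ennreal. f \<in> borel_measurable (borel \<Otimes>\<^sub>M borel) \<Longrightarrow>
      (\<integral>\<^sup>+Z. f (\<Sum>k<n. u k * Z k, \<Sum>k<n. w k * Z k) \<partial>std_gauss n) =
      (\<integral>\<^sup>+x. \<integral>\<^sup>+y. f (a * x, b * x + c * y) \<partial>std_normal \<partial>std_normal)"
    by blast
  define p q where "p = u n" and "q = w n"
  define r where "r = sqrt (a\<^sup>2 + p\<^sup>2)"
  \<comment> \<open>First rotation, in the plane of \<open>x\<close> and the new coordinate
    \<open>z\<close>: it turns the first form into \<open>r * x\<close> and leaves the second with
    coefficients \<open>b'\<close> on \<open>x\<close> and \<open>q'\<close> on
    \<open>z\<close>.\<close>
  obtain \<alpha> \<beta> where ab: "\<alpha> \<ge> 0" "\<alpha>\<^sup>2 + \<beta>\<^sup>2 = 1" "a = r * \<alpha>" "p = r * \<beta>"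
    using polar_coordinates_nonneg[OF nn(1), of p] unfolding r_def by metis
  define b' q' where "b' = b * \<alpha> + q * \<beta>" and "q' = q * \<alpha> - b * \<beta>"
  define c' where "c' = sqrt (c\<^sup>2 + q'\<^sup>2)"
  \<comment> \<open>Second rotation, in the plane of \<open>y\<close> and \<open>z\<close>: it
    absorbs \<open>q'\<close> into \<open>c'\<close> and does not touch \<open>x\<close>, so the
    first form keeps its shape.\<close>
  obtain \<gamma> \<eta> where ce: "\<gamma> \<ge> 0" "\<gamma>\<^sup>2 + \<eta>\<^sup>2 = 1" "c = c' * \<gamma>" "q' = c' * \<eta>"
    using polar_coordinates_nonneg[OF nn(2), of q'] unfolding c'_def by metis
  have "r * b' = b * a + q * p"
    by (simp add: b'_def ab algebra_simps)
  moreover have "b'\<^sup>2 + c'\<^sup>2 = b\<^sup>2 + c\<^sup>2 + q\<^sup>2"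
  proof -
    have "b'\<^sup>2 + c'\<^sup>2 = c\<^sup>2 + (b'\<^sup>2 + q'\<^sup>2)"
      by (simp add: c'_def)
    also have "b'\<^sup>2 + q'\<^sup>2 = (\<alpha>\<^sup>2 + \<beta>\<^sup>2) * (b\<^sup>2 + q\<^sup>2)"
      unfolding b'_def q'_def by (simp add: power2_eq_square algebra_simps)
    finally show ?thesis using ab(2) by simp
  qed
  moreover have "(\<integral>\<^sup>+Z. f (\<Sum>k<Suc n. u k * Z k, \<Sum>k<Suc n. w k * Z k) \<partial>std_gauss (Suc n)) =
      (\<integral>\<^sup>+x. \<integral>\<^sup>+y. f (r * x, b' * x + c' * y) \<partial>std_normal \<partial>std_normal)"
    if [measurable]: "f \<in> borel_measurable (borel \<Otimes>\<^sub>M borel)" for f :: "real \<times> real \<Rightarrow> ennreal"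
  proof -
    have "(\<integral>\<^sup>+Z. f (\<Sum>k<Suc n. u k * Z k, \<Sum>k<Suc n. w k * Z k) \<partial>std_gauss (Suc n)) =
        (\<integral>\<^sup>+Z. \<integral>\<^sup>+z. f ((\<Sum>k<n. u k * Z k) + p * z, (\<Sum>k<n. w k * Z k) + q * z) \<partial>std_normal \<partial>std_gauss n)"
      by (subst std_gauss_Suc_nn_integral) (simp_all add: p_def q_def)
    also have "\<dots> = (\<integral>\<^sup>+x. \<integral>\<^sup>+y. \<integral>\<^sup>+z. f (a * x + p * z, b * x + c * y + q * z) \<partial>std_normal \<partial>std_normal \<partial>std_normal)"
      by (subst IH[of "\<lambda>(s, d). \<integral>\<^sup>+z. f (s + p * z, d + q * z) \<partial>std_normal", simplified]) simp_all
    \<comment> \<open>The order of integration is changed so that \<open>x\<close> and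
      \<open>z\<close> are the two outer variables, on which the first rotation acts.\<close>
    also have "\<dots> = (\<integral>\<^sup>+x. \<integral>\<^sup>+z. \<integral>\<^sup>+y. f (a * x + p * z, b * x + c * y + q * z) \<partial>std_normal \<partial>std_normal \<partial>std_normal)"
      by (intro nn_integral_cong std_normal_pair.Fubini') measurable
    also have "\<dots> = (\<integral>\<^sup>+x. \<integral>\<^sup>+z. \<integral>\<^sup>+y. f (a * (\<alpha> * x - \<beta> * z) + p * (\<beta> * x + \<alpha> * z),
          b * (\<alpha> * x - \<beta> * z) + c * y + q * (\<beta> * x + \<alpha> * z)) \<partial>std_normal \<partial>std_normal \<partial>std_normal)"
      by (subst std_normal_pair_rotation[OF _ ab(1,2),
            of "\<lambda>(x, z). \<integral>\<^sup>+y. f (a * x + p * z, b * x + c * y + q * z) \<partial>std_normal", simplified]) simp_all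
    also have "\<dots> = (\<integral>\<^sup>+x. \<integral>\<^sup>+z. \<integral>\<^sup>+y. f (r * x, b' * x + c * y + q' * z) \<partial>std_normal \<partial>std_normal \<partial>std_normal)"
    proof -
      have 1: "a * (\<alpha> * x - \<beta> * z) + p * (\<beta> * x + \<alpha> * z) = r * x" for x z
      proof -
        have "a * (\<alpha> * x - \<beta> * z) + p * (\<beta> * x + \<alpha> * z) = r * ((\<alpha>\<^sup>2 + \<beta>\<^sup>2) * x)"
          unfolding ab(3,4) by (simp add: power2_eq_square algebra_simps)
        then show ?thesis using ab(2) by simp
      qed
      have 2: "b * (\<alpha> * x - \<beta> * z) + c * y + q * (\<beta> * x + \<alpha> * z) = b' * x + c * y + q' * z" for x y z
        by (simp add: b'_def q'_def algebra_simps)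
      show ?thesis by (simp only: 1 2)
    qed
    also have "\<dots> = (\<integral>\<^sup>+x. \<integral>\<^sup>+y. \<integral>\<^sup>+z. f (r * x, b' * x + c * y + q' * z) \<partial>std_normal \<partial>std_normal \<partial>std_normal)"
      by (intro nn_integral_cong std_normal_pair.Fubini') measurable
    also have "\<dots> = (\<integral>\<^sup>+x. \<integral>\<^sup>+y. \<integral>\<^sup>+z. f (r * x, b' * x + c * (\<gamma> * y - \<eta> * z) + q' * (\<eta> * y + \<gamma> * z)) \<partial>std_normal \<partial>std_normal \<partial>std_normal)"
      by (subst std_normal_pair_rotation[OF _ ce(1,2),
            of "\<lambda>(y, z). f (r * x, b' * x + c * y + q' * z)" for x, simplified]) simp_all
    also have "\<dots> = (\<integral>\<^sup>+x. \<integral>\<^sup>+y. \<integral>\<^sup>+z. f (r * x, b' * x + c' * y) \<partial>std_normal \<partial>std_normal \<partial>std_normal)"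
    proof -
      have "b' * x + c * (\<gamma> * y - \<eta> * z) + q' * (\<eta> * y + \<gamma> * z) = b' * x + c' * y" for x y z
      proof -
        have "b' * x + c * (\<gamma> * y - \<eta> * z) + q' * (\<eta> * y + \<gamma> * z) = b' * x + c' * ((\<gamma>\<^sup>2 + \<eta>\<^sup>2) * y)"
          unfolding ce(3,4) by (simp add: power2_eq_square algebra_simps)
        then show ?thesis using ce(2) by simp
      qed
      then show ?thesis by (simp only:)
    qed
    also have "\<dots> = (\<integral>\<^sup>+x. \<integral>\<^sup>+y. f (r * x, b' * x + c' * y) \<partial>std_normal \<partial>std_normal)"
      by (simp add: std_normal.emeasure_space_1[simplified])
    finally show ?thesis .
  qed
  moreover have "r \<ge> 0" "c' \<ge> 0" "r\<^sup>2 = a\<^sup>2 + p\<^sup>2"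
    by (simp_all add: r_def c'_def)
  ultimately show ?case
    using gram by - (rule exI[of _ r], rule exI[of _ b'], rule exI[of _ c'], simp add: p_def q_def mult.commute)
qed

text \<open>A nonzero \<open>u\<close> orthogonal to \<open>w\<close> forces the off-diagonal
  Cholesky entry \<open>b\<close> to vanish: uncorrelated Gaussian forms are independent.\<close>

lemma orthogonal_linear_forms_nn_integral:
  fixes u w :: "nat \<Rightarrow> real" and f :: "real \<times> real \<Rightarrow> ennreal"
  assumes "(\<Sum>k<n. (u k)\<^sup>2) > 0" and "(\<Sum>k<n. u k * w k) = 0"
    and f: "f \<in> borel_measurable (borel \<Otimes>\<^sub>M borel)"
  shows "(\<integral>\<^sup>+Z. f (\<Sum>k<n. u k * Z k, \<Sum>k<n. w k * Z k) \<partial>std_gauss n) =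
    (\<integral>\<^sup>+x. \<integral>\<^sup>+y. f (sqrt (\<Sum>k<n. (u k)\<^sup>2) * x, sqrt (\<Sum>k<n. (w k)\<^sup>2) * y) \<partial>std_normal \<partial>std_normal)"
proof -
  obtain a b c where nn: "a \<ge> 0" "c \<ge> 0"
    and gram: "a\<^sup>2 = (\<Sum>k<n. (u k)\<^sup>2)" "a * b = (\<Sum>k<n. u k * w k)" "b\<^sup>2 + c\<^sup>2 = (\<Sum>k<n. (w k)\<^sup>2)"
    and eq: "(\<integral>\<^sup>+Z. f (\<Sum>k<n. u k * Z k, \<Sum>k<n. w k * Z k) \<partial>std_gauss n) =
      (\<integral>\<^sup>+x. \<integral>\<^sup>+y. f (a * x, b * x + c * y) \<partial>std_normal \<partial>std_normal)"
    using linear_forms_canonical[where n=n and u=u and w=w] f by blast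
  have "b = 0"
    using gram(1,2) assms by auto
  moreover have "sqrt (\<Sum>k<n. (u k)\<^sup>2) = a" "sqrt (\<Sum>k<n. (w k)\<^sup>2) = c"
    using gram nn \<open>b = 0\<close> by (auto simp flip: gram(1,3))
  ultimately show ?thesis
    using eq by simp
qed

section \<open>Hellinger affinity and the two-point bound\<close>

text \<open>Puts all samples on one common base space, where the likelihood ratio is a product over
  the coordinates. Boxes determine a product measure, and on a box both sides factor into the same
  one-coordinate integrals.\<close>

lemma PiM_distr_density:
  fixes N :: "'i \<Rightarrow> 'b measure" and g :: "'i \<Rightarrow> 'a \<Rightarrow> ennreal"
  assumes I: "finite I" and "prob_space M"
    and g [measurable]: "\<And>i. g i \<in> borel_measurable M" and g1: "\<And>i. (\<integral>\<^sup>+x. g i x \<partial>M) = 1"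
    and h [measurable]: "\<And>i. h i \<in> measurable M (N i)"
  shows "PiM I (\<lambda>i. distr (density M (g i)) (N i) (h i)) =
    distr (density (PiM I (\<lambda>_. M)) (\<lambda>x. \<Prod>i\<in>I. g i (x i))) (PiM I N) (\<lambda>x. \<lambda>i\<in>I. h i (x i))"
    (is "PiM I ?Q = ?R")
proof -
  have dens: "prob_space (density M (g i))" for i
    by (rule prob_spaceI) (simp add: emeasure_density g1)
  have Q: "prob_space (?Q i)" for i
    by (intro prob_space.prob_space_distr dens) simp
  interpret product_sigma_finite ?Q
    using Q by (simp add: product_sigma_finite_def prob_space_imp_sigma_finite)
  interpret M: product_sigma_finite "\<lambda>_::'i. M"
    using \<open>prob_space M\<close> by (simp add: product_sigma_finite_def prob_space_imp_sigma_finite)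
  have H [measurable]: "(\<lambda>x. \<lambda>i\<in>I. h i (x i)) \<in> measurable (PiM I (\<lambda>_. M)) (PiM I N)"
    by measurable
  have G [measurable]: "(\<lambda>x. \<Prod>i\<in>I. g i (x i)) \<in> borel_measurable (PiM I (\<lambda>_. M))"
    by measurable
  show ?thesis
  proof (rule PiM_eqI[OF I, symmetric])
    show "sets ?R = sets (PiM I ?Q)"
      by (simp cong: sets_PiM_cong)
    fix A assume "\<And>i. i \<in> I \<Longrightarrow> A i \<in> sets (?Q i)"
    then have A [measurable]: "\<And>i. i \<in> I \<Longrightarrow> A i \<in> sets (N i)"
      by simp
    have Pi_A: "Pi\<^sub>E I A \<in> sets (PiM I N)"
      using I A by (rule sets_PiM_I_finite)
    have "emeasure ?R (Pi\<^sub>E I A) = (\<integral>\<^sup>+x. (\<Prod>i\<in>I. g i (x i)) *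
        indicator ((\<lambda>x. \<lambda>i\<in>I. h i (x i)) -` Pi\<^sub>E I A \<inter> space (PiM I (\<lambda>_. M))) x \<partial>PiM I (\<lambda>_. M))"
      using measurable_sets[OF H Pi_A] Pi_A by (simp add: emeasure_distr emeasure_density)
    also have "\<dots> = (\<integral>\<^sup>+x. (\<Prod>i\<in>I. g i (x i) * indicator (h i -` A i \<inter> space M) (x i)) \<partial>PiM I (\<lambda>_. M))"
    proof (rule nn_integral_cong)
      fix x assume x: "x \<in> space (PiM I (\<lambda>_. M))"
      then have "\<forall>i\<in>I. x i \<in> space M"
        by (auto simp: space_PiM PiE_def Pi_def)
      then have "indicator ((\<lambda>x. \<lambda>i\<in>I. h i (x i)) -` Pi\<^sub>E I A \<inter> space (PiM I (\<lambda>_. M))) x =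
          (\<Prod>i\<in>I. indicator (h i -` A i \<inter> space M) (x i) :: ennreal)"
        using x I by (auto simp: indicator_def PiE_iff prod_eq_1_iff prod_zero_iff intro!: prod.neutral[symmetric])
      then show "(\<Prod>i\<in>I. g i (x i)) * indicator ((\<lambda>x. \<lambda>i\<in>I. h i (x i)) -` Pi\<^sub>E I A \<inter> space (PiM I (\<lambda>_. M))) x =
          (\<Prod>i\<in>I. g i (x i) * indicator (h i -` A i \<inter> space M) (x i))"
        by (simp add: prod.distrib)
    qed
    also have "\<dots> = (\<Prod>i\<in>I. \<integral>\<^sup>+x. g i x * indicator (h i -` A i \<inter> space M) x \<partial>M)"
      by (rule M.product_nn_integral_prod[OF I, where f = "\<lambda>i x. g i x * indicator (h i -` A i \<inter> space M) x"]) measurable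
    also have "\<dots> = (\<Prod>i\<in>I. emeasure (?Q i) (A i))"
      using A by (intro prod.cong refl) (simp add: emeasure_distr emeasure_density)
    finally show "emeasure ?R (Pi\<^sub>E I A) = (\<Prod>i\<in>I. emeasure (?Q i) (A i))" .
  qed
qed

text \<open>Since \<open>g = min 1 g * max 1 g\<close>, AM-GM with the factors weighted by
  \<open>l\<close> and \<open>1 / l\<close> separates them. Relaxing \<open>max 1 g\<close> to
  \<open>1 + g\<close> gives a term whose integral is 2 when \<open>g\<close> is a probability
  density.\<close>

lemma sqrt_le_min_add:
  fixes g l :: real
  assumes "g \<ge> 0" "l > 0"
  shows "sqrt g \<le> l / 2 * min 1 g + 1 / (2 * l) * (1 + g)"
proof -
  have "sqrt g = sqrt (l * min 1 g) * sqrt (max 1 g / l)"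
    using assms by (simp add: real_sqrt_mult[symmetric] min_def max_def)
  also have "\<dots> \<le> ((sqrt (l * min 1 g))\<^sup>2 + (sqrt (max 1 g / l))\<^sup>2) / 2"
    using sum_squares_bound[of "sqrt (l * min 1 g)" "sqrt (max 1 g / l)"] by (simp add: field_simps)
  also have "\<dots> = l / 2 * min 1 g + 1 / (2 * l) * max 1 g"
    using assms by (simp add: field_simps)
  also have "\<dots> \<le> l / 2 * min 1 g + 1 / (2 * l) * (1 + g)"
    using assms by (intro add_left_mono mult_left_mono) auto
  finally show ?thesis .
qed

text \<open>Le Cam's inequality, with the preceding weighted AM--GM bound at \<open>l = 2 / B\<close> in place of
  Cauchy--Schwarz.\<close>

lemma affinity_le_overlap:
  assumes "prob_space M" and [measurable]: "g \<in> borel_measurable M" and g0: "\<And>x. 0 \<le> g x"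
    and g1: "(\<integral>\<^sup>+x. ennreal (g x) \<partial>M) = 1" and B: "(\<integral>\<^sup>+x. ennreal (sqrt (g x)) \<partial>M) = ennreal B" "B > 0"
  shows "ennreal (B\<^sup>2 / 2) \<le> (\<integral>\<^sup>+x. ennreal (min 1 (g x)) \<partial>M)"
proof -
  interpret prob_space M by fact
  have "(\<integral>\<^sup>+x. ennreal (min 1 (g x)) \<partial>M) \<le> (\<integral>\<^sup>+x. 1 \<partial>M)"
    by (intro nn_integral_mono) auto
  then obtain m where m: "(\<integral>\<^sup>+x. ennreal (min 1 (g x)) \<partial>M) = ennreal m" "m \<ge> 0"
    by (cases "\<integral>\<^sup>+x. ennreal (min 1 (g x)) \<partial>M") (auto simp: emeasure_space_1 top_unique)
  \<comment> \<open>This weight maximises \<open>2 / l * (B - 1 / l)\<close>, the lower bound for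
    the overlap that the inequality yields.\<close>
  define l where "l = 2 / B"
  have l: "l > 0" using B by (simp add: l_def)
  have "ennreal B \<le> (\<integral>\<^sup>+x. ennreal (l / 2) * ennreal (min 1 (g x)) + ennreal (1 / (2 * l)) * (1 + ennreal (g x)) \<partial>M)"
    unfolding B(1)[symmetric]
  proof (rule nn_integral_mono)
    fix x
    have "ennreal (sqrt (g x)) \<le> ennreal (l / 2 * min 1 (g x) + 1 / (2 * l) * (1 + g x))"
      using sqrt_le_min_add[OF g0 l, of x] by (rule ennreal_leI)
    also have "\<dots> = ennreal (l / 2) * ennreal (min 1 (g x)) + ennreal (1 / (2 * l)) * (1 + ennreal (g x))"
      using l g0[of x] by (simp flip: ennreal_plus ennreal_mult ennreal_1)
    finally show "ennreal (sqrt (g x)) \<le> \<dots>" .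
  qed
  also have "\<dots> = ennreal (l / 2) * ennreal m + ennreal (1 / (2 * l)) * 2"
    by (simp add: nn_integral_add nn_integral_cmult m(1) g1 emeasure_space_1)
  also have "\<dots> = ennreal (l / 2 * m + 1 / l)"
    using l m(2) by (simp flip: ennreal_plus ennreal_mult ennreal_numeral)
  finally have "B \<le> l / 2 * m + 1 / l"
    using l m(2) by (subst (asm) ennreal_le_iff) auto
  then have "B\<^sup>2 / 2 \<le> m"
    using B(2) by (simp add: l_def field_simps power2_eq_square)
  then show ?thesis
    by (simp add: m(1) ennreal_leI)
qed

lemma sqrt_prod: "sqrt (\<Prod>i\<in>I. f i) = (\<Prod>i\<in>I. sqrt (f i))"
  by (induction I rule: infinite_finite_induct) (auto simp: real_sqrt_mult)

text \<open>Affinities multiply over independent coordinates. Because the error events cover the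
  space, each point of the base space contributes \<open>1\<close> or the likelihood ratio
  \<open>G\<close> to the sum of the errors, hence at least \<open>min 1 G\<close>. The maps
  \<open>h\<close> allow the data to be any function of the base variables.\<close>

lemma product_two_point_bound:
  fixes N :: "'i \<Rightarrow> 'b measure" and g :: "'i \<Rightarrow> 'a \<Rightarrow> real" and B :: "'i \<Rightarrow> real"
  assumes I: "finite I" and M: "prob_space M"
    and g [measurable]: "\<And>i. g i \<in> borel_measurable M" and g0: "\<And>i x. 0 \<le> g i x"
    and g1: "\<And>i. (\<integral>\<^sup>+x. ennreal (g i x) \<partial>M) = 1"
    and B: "\<And>i. (\<integral>\<^sup>+x. ennreal (sqrt (g i x)) \<partial>M) = ennreal (B i)" "\<And>i. B i > 0"
    and h [measurable]: "\<And>i. h i \<in> measurable M (N i)"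
    and E: "E1 \<in> sets (PiM I N)" "E2 \<in> sets (PiM I N)" "space (PiM I N) \<subseteq> E1 \<union> E2"
  shows "(\<Prod>i\<in>I. B i)\<^sup>2 / 2 \<le>
    measure (PiM I (\<lambda>i. distr M (N i) (h i))) E1 +
    measure (PiM I (\<lambda>i. distr (density M (\<lambda>x. ennreal (g i x))) (N i) (h i))) E2"
    (is "_ \<le> measure ?P E1 + measure ?Q E2")
proof -
  interpret M: prob_space M by fact
  interpret MI: product_prob_space "\<lambda>_::'i. M" I ..
  define MI where "MI = PiM I (\<lambda>_. M)"
  define H where "H = (\<lambda>x. \<lambda>i\<in>I. h i (x i))"
  define G where "G = (\<lambda>x. \<Prod>i\<in>I. g i (x i))"
  have pMI: "prob_space MI"
    unfolding MI_def by (rule MI.prob_space_axioms)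
  have H [measurable]: "H \<in> measurable MI (PiM I N)"
    unfolding H_def MI_def by measurable
  have G [measurable]: "G \<in> borel_measurable MI"
    unfolding G_def MI_def by measurable
  have G0: "G x \<ge> 0" for x
    by (simp add: G_def g0 prod_nonneg)
  have Q: "?Q = distr (density MI G) (PiM I N) H"
    using PiM_distr_density[OF I M, of "\<lambda>i x. ennreal (g i x)" h N]
    by (simp add: g1 g0 MI_def H_def G_def prod_ennreal)
  \<comment> \<open>The first law is the case of constant density one.\<close>
  have P: "?P = distr MI (PiM I N) H"
    using PiM_distr_density[OF I M, of "\<lambda>i x. 1" h N]
    by (simp add: M.emeasure_space_1 MI_def H_def density_1)
  have G1: "(\<integral>\<^sup>+x. ennreal (G x) \<partial>MI) = 1"
    using MI.product_nn_integral_prod[OF I, of "\<lambda>i x. ennreal (g i x)"]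
    by (simp add: g1 g0 MI_def G_def prod_ennreal)
  have "(\<integral>\<^sup>+x. ennreal (sqrt (G x)) \<partial>MI) = (\<integral>\<^sup>+x. (\<Prod>i\<in>I. ennreal (sqrt (g i (x i)))) \<partial>MI)"
    by (simp add: G_def sqrt_prod prod_ennreal g0)
  also have "\<dots> = ennreal (\<Prod>i\<in>I. B i)"
    using MI.product_nn_integral_prod[OF I, of "\<lambda>i x. ennreal (sqrt (g i x))"] B
    by (simp add: MI_def prod_ennreal less_imp_le)
  finally have GB: "(\<integral>\<^sup>+x. ennreal (sqrt (G x)) \<partial>MI) = ennreal (\<Prod>i\<in>I. B i)" .
  have pP: "prob_space ?P" unfolding P
    by (rule prob_space.prob_space_distr[OF pMI H])
  have "prob_space (density MI G)"
    by (rule prob_spaceI) (simp add: emeasure_density G1)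
  then have pQ: "prob_space ?Q" unfolding Q
    by (rule prob_space.prob_space_distr) simp
  have pre [measurable]: "H -` E1 \<inter> space MI \<in> sets MI" "H -` E2 \<inter> space MI \<in> sets MI"
    using E H by (auto intro: measurable_sets)
  have "ennreal ((\<Prod>i\<in>I. B i)\<^sup>2 / 2) \<le> (\<integral>\<^sup>+x. ennreal (min 1 (G x)) \<partial>MI)"
    using B(2) by (intro affinity_le_overlap[OF pMI G G0 G1 GB]) (auto intro: prod_pos)
  also have "\<dots> \<le> (\<integral>\<^sup>+x. indicator (H -` E1 \<inter> space MI) x + ennreal (G x) * indicator (H -` E2 \<inter> space MI) x \<partial>MI)"
  proof (rule nn_integral_mono)
    fix x assume x: "x \<in> space MI"
    then have "H x \<in> E1 \<union> E2"
      using measurable_space[OF H x] E(3) by auto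
    moreover have "ennreal (min 1 (G x)) \<le> 1" "ennreal (min 1 (G x)) \<le> ennreal (G x)"
      by (auto intro: ennreal_leI)
    ultimately show "ennreal (min 1 (G x)) \<le> indicator (H -` E1 \<inter> space MI) x + ennreal (G x) * indicator (H -` E2 \<inter> space MI) x"
      using x by (auto simp: indicator_def add_increasing2)
  qed
  also have "\<dots> = emeasure ?P E1 + emeasure ?Q E2"
    using E unfolding P Q by (simp add: nn_integral_add emeasure_distr emeasure_density)
  also have "\<dots> = ennreal (measure ?P E1 + measure ?Q E2)"
    by (simp add: ennreal_plus finite_measure.emeasure_eq_measure prob_space.finite_measure[OF pP]
        prob_space.finite_measure[OF pQ] del: ennreal_plus[symmetric])
  finally show ?thesis
    by (subst (asm) ennreal_le_iff) auto
qed

section \<open>Normal laws that differ in scale\<close>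

text \<open>The likelihood ratio that multiplies the second coordinate of a standard normal pair by
  \<open>\<rho>\<close>. The first coordinate keeps its law, so its density cancels from the
  ratio.\<close>

definition normal_scale_ratio :: "real \<Rightarrow> real \<times> real \<Rightarrow> real" where
  "normal_scale_ratio \<rho> p = normal_density 0 \<rho> (snd p) / std_normal_density (snd p)"

lemma normal_scale_ratio_measurable [measurable]:
  "normal_scale_ratio \<rho> \<in> borel_measurable (std_normal \<Otimes>\<^sub>M std_normal)"
  unfolding normal_scale_ratio_def by measurable

lemma normal_scale_ratio_nonneg: "normal_scale_ratio \<rho> p \<ge> 0"
  by (simp add: normal_scale_ratio_def)

text \<open>Substituting \<open>\<rho> * y\<close> for \<open>y\<close> turns the density of
  deviation \<open>\<rho>\<close>, times the Jacobian \<open>\<rho>\<close>, into the standard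
  one.\<close>

lemma nn_integral_std_normal_scale:
  fixes f :: "real \<Rightarrow> ennreal"
  assumes "\<rho> > 0" and [measurable]: "f \<in> borel_measurable borel"
  shows "(\<integral>\<^sup>+y. f (\<rho> * y) \<partial>std_normal) =
    (\<integral>\<^sup>+y. ennreal (normal_density 0 \<rho> y / std_normal_density y) * f y \<partial>std_normal)"
proof -
  have d: "ennreal \<rho> * ennreal (normal_density 0 \<rho> (\<rho> * y)) = ennreal (std_normal_density y)" for y
    using \<open>\<rho> > 0\<close>
    by (simp add: normal_density_def real_sqrt_mult power_mult_distrib flip: ennreal_mult)
  have pos: "std_normal_density y > 0" for y
    by (rule normal_density_pos) simp
  have "(\<integral>\<^sup>+y. ennreal (normal_density 0 \<rho> y / std_normal_density y) * f y \<partial>std_normal) =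
      (\<integral>\<^sup>+y. ennreal (std_normal_density y) * (ennreal (normal_density 0 \<rho> y / std_normal_density y) * f y) \<partial>lborel)"
    by (simp add: std_normal_def nn_integral_density)
  also have "\<dots> = (\<integral>\<^sup>+y. ennreal (normal_density 0 \<rho> y) * f y \<partial>lborel)"
    using less_imp_neq[OF pos] by (simp flip: mult.assoc ennreal_mult)
  also have "\<dots> = ennreal \<rho> * (\<integral>\<^sup>+y. ennreal (normal_density 0 \<rho> (\<rho> * y)) * f (\<rho> * y) \<partial>lborel)"
    using nn_integral_real_affine[of "\<lambda>y. ennreal (normal_density 0 \<rho> y) * f y" \<rho> 0] \<open>\<rho> > 0\<close> by simp
  also have "\<dots> = (\<integral>\<^sup>+y. ennreal \<rho> * (ennreal (normal_density 0 \<rho> (\<rho> * y)) * f (\<rho> * y)) \<partial>lborel)"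
    by (subst nn_integral_cmult) auto
  also have "\<dots> = (\<integral>\<^sup>+y. f (\<rho> * y) \<partial>std_normal)"
    by (simp add: std_normal_def nn_integral_density d flip: mult.assoc)
  finally show ?thesis by simp
qed

lemma normal_scale_ratio_integral:
  assumes "\<rho> > 0"
  shows "(\<integral>\<^sup>+p. ennreal (normal_scale_ratio \<rho> p) \<partial>(std_normal \<Otimes>\<^sub>M std_normal)) = 1"
  using nn_integral_std_normal_scale[OF assms, of "\<lambda>_. 1"]
  by (simp add: std_normal.nn_integral_fst[symmetric] normal_scale_ratio_def
      std_normal.emeasure_space_1[simplified])

text \<open>The geometric mean of two centered normal densities is a multiple of a third one, whose
  variance \<open>\<tau>\<^sup>2\<close> is the harmonic mean of \<open>1\<close> and
  \<open>\<rho>\<^sup>2\<close>. That multiple is the affinity.\<close>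

lemma normal_scale_ratio_affinity:
  assumes "\<rho> > 0"
  shows "(\<integral>\<^sup>+p. ennreal (sqrt (normal_scale_ratio \<rho> p)) \<partial>(std_normal \<Otimes>\<^sub>M std_normal)) =
    ennreal (sqrt (2 * \<rho> / (1 + \<rho>\<^sup>2)))"
proof -
  define \<tau> where "\<tau> = sqrt (2 * \<rho>\<^sup>2 / (1 + \<rho>\<^sup>2))"
  have pos: "1 + \<rho>\<^sup>2 > 0"
    by (simp add: add_pos_nonneg)
  then have \<tau>: "\<tau> > 0" "\<tau>\<^sup>2 = 2 * \<rho>\<^sup>2 / (1 + \<rho>\<^sup>2)"
    using assms by (simp_all add: \<tau>_def)
  have d: "std_normal_density y * sqrt (normal_density 0 \<rho> y / std_normal_density y) =
      sqrt (2 * \<rho> / (1 + \<rho>\<^sup>2)) * normal_density 0 \<tau> y" for y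
  \<comment> \<open>Both sides are nonnegative, so comparing squares removes the nested
    roots.\<close>
  proof (rule power2_eq_imp_eq)
    have e: "exp (- y\<^sup>2 / 2) * exp (- y\<^sup>2 / (2 * \<rho>\<^sup>2)) = (exp (- y\<^sup>2 / (2 * \<tau>\<^sup>2)))\<^sup>2"
      using assms pos by (simp add: \<tau>(2) power2_eq_square[of "exp _"] field_simps flip: exp_add)
    have "(std_normal_density y * sqrt (normal_density 0 \<rho> y / std_normal_density y))\<^sup>2 =
        std_normal_density y * normal_density 0 \<rho> y"
      using normal_density_pos[of 1 0 y]
      by (simp add: power_mult_distrib, simp add: power2_eq_square)
    also have "\<dots> = (exp (- y\<^sup>2 / 2) * exp (- y\<^sup>2 / (2 * \<rho>\<^sup>2))) / (2 * pi * \<rho>)"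
    proof -
      have "sqrt (2 * pi) * sqrt (2 * pi * \<rho>\<^sup>2) = 2 * pi * \<rho>"
        using assms real_sqrt_mult[of "2 * pi" "\<rho>\<^sup>2"] by (simp flip: mult.assoc)
      then show ?thesis by (simp add: normal_density_def)
    qed
    also have "\<dots> = 2 * \<rho> / (1 + \<rho>\<^sup>2) * ((exp (- y\<^sup>2 / (2 * \<tau>\<^sup>2)))\<^sup>2 / (2 * pi * \<tau>\<^sup>2))"
    proof -
      have "X / (2 * pi * \<rho>) = 2 * \<rho> / q * (X / (2 * pi * (2 * \<rho>\<^sup>2 / q)))" if "q > 0" for X q :: real
        using assms that by (simp add: field_simps power2_eq_square)
      from this[OF pos] show ?thesis unfolding e \<tau>(2) .
    qed
    also have "\<dots> = (sqrt (2 * \<rho> / (1 + \<rho>\<^sup>2)) * normal_density 0 \<tau> y)\<^sup>2"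
      using assms pos \<tau>(1) by (simp add: normal_density_def power_mult_distrib power_divide)
    finally show "(std_normal_density y * sqrt (normal_density 0 \<rho> y / std_normal_density y))\<^sup>2 =
      (sqrt (2 * \<rho> / (1 + \<rho>\<^sup>2)) * normal_density 0 \<tau> y)\<^sup>2" .
  qed (use assms in auto)
  have "(\<integral>\<^sup>+y. ennreal (sqrt (normal_density 0 \<rho> y / std_normal_density y)) \<partial>std_normal) =
      (\<integral>\<^sup>+y. ennreal (sqrt (2 * \<rho> / (1 + \<rho>\<^sup>2))) * ennreal (normal_density 0 \<tau> y) \<partial>lborel)"
    using assms by (simp add: std_normal_def nn_integral_density d flip: ennreal_mult)
  also have "\<dots> = ennreal (sqrt (2 * \<rho> / (1 + \<rho>\<^sup>2)))"
    using \<tau>(1) by (simp add: nn_integral_cmult nn_integral_eq_integral)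
  finally show ?thesis
    by (simp add: std_normal.nn_integral_fst[symmetric] normal_scale_ratio_def
      std_normal.emeasure_space_1[simplified])
qed

text \<open>Moves the scale from the map into the base measure, so that both hypotheses use the same
  \<open>h\<close>, as \<open>product_two_point_bound\<close> demands.\<close>

lemma distr_std_normal_pair_scale:
  assumes "\<rho> > 0" and h [measurable]: "h \<in> measurable (std_normal \<Otimes>\<^sub>M std_normal) N"
  shows "distr (std_normal \<Otimes>\<^sub>M std_normal) N (\<lambda>(x, y). h (x, \<rho> * y)) =
    distr (density (std_normal \<Otimes>\<^sub>M std_normal) (normal_scale_ratio \<rho>)) N h"
proof (rule measure_eqI)
  fix A assume "A \<in> sets (distr (std_normal \<Otimes>\<^sub>M std_normal) N (\<lambda>(x, y). h (x, \<rho> * y)))"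
  then have A [measurable]: "A \<in> sets N" by simp
  have "emeasure (distr (std_normal \<Otimes>\<^sub>M std_normal) N (\<lambda>(x, y). h (x, \<rho> * y))) A =
      (\<integral>\<^sup>+p. indicator A (h (fst p, \<rho> * snd p)) \<partial>(std_normal \<Otimes>\<^sub>M std_normal))"
    by (subst nn_integral_indicator[symmetric], simp)
       (subst nn_integral_distr, auto simp: case_prod_beta)
  also have "\<dots> = (\<integral>\<^sup>+x. \<integral>\<^sup>+y. indicator A (h (x, \<rho> * y)) \<partial>std_normal \<partial>std_normal)"
    by (simp add: std_normal.nn_integral_fst[symmetric])
  also have "\<dots> = (\<integral>\<^sup>+x. \<integral>\<^sup>+y. ennreal (normal_scale_ratio \<rho> (x, y)) * indicator A (h (x, y)) \<partial>std_normal \<partial>std_normal)"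
    using assms(1) by (subst nn_integral_std_normal_scale) (auto simp: normal_scale_ratio_def)
  also have "\<dots> = (\<integral>\<^sup>+p. ennreal (normal_scale_ratio \<rho> p) * indicator A (h p) \<partial>(std_normal \<Otimes>\<^sub>M std_normal))"
    by (simp add: std_normal.nn_integral_fst[symmetric])
  also have "\<dots> = (\<integral>\<^sup>+z. indicator A z \<partial>distr (density (std_normal \<Otimes>\<^sub>M std_normal) (normal_scale_ratio \<rho>)) N h)"
    by (simp add: nn_integral_distr nn_integral_density del: nn_integral_indicator)
  also have "\<dots> = emeasure (distr (density (std_normal \<Otimes>\<^sub>M std_normal) (normal_scale_ratio \<rho>)) N h) A"
    by simp
  finally show "emeasure (distr (std_normal \<Otimes>\<^sub>M std_normal) N (\<lambda>(x, y). h (x, \<rho> * y))) A =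
    emeasure (distr (density (std_normal \<Otimes>\<^sub>M std_normal) (normal_scale_ratio \<rho>)) N h) A" .
qed simp

section \<open>Orderings of triples\<close>

text \<open>One explicit factor \<open>A\<close> is enough to make the Hilbert choice behind
  \<open>sqrt_factor\<close> a genuine factor of \<open>S\<close>.\<close>

lemma sqrt_factor_gram:
  assumes "\<And>a b. a < n \<Longrightarrow> b < n \<Longrightarrow> (\<Sum>k<n. A a k * A b k) = S a b" "a < n" "b < n"
  shows "(\<Sum>k<n. sqrt_factor n S a k * sqrt_factor n S b k) = S a b"
proof -
  have "\<exists>A. \<forall>a<n. \<forall>b<n. (\<Sum>k<n. A a k * A b k) = S a b"
    using assms(1) by blast
  from someI_ex[OF this] show ?thesis
    using assms(2,3) by (simp add: sqrt_factor_def)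
qed

text \<open>Insertion sort consults the keys only through comparisons.\<close>

lemma sort_key_cong_order:
  assumes "\<And>a b. a \<in> set xs \<Longrightarrow> b \<in> set xs \<Longrightarrow> f a \<le> f b \<longleftrightarrow> g a \<le> g b"
  shows "sort_key f xs = sort_key g xs"
proof -
  have ins: "insort_key f x ys = insort_key g x ys"
    if "\<And>b. b \<in> set ys \<Longrightarrow> f x \<le> f b \<longleftrightarrow> g x \<le> g b" for x ys
    using that by (induction ys) auto
  show ?thesis
    using assms
  proof (induction xs)
    case (Cons x xs)
    then show ?case
      using ins[of "sort_key g xs" x] by simp
  qed simp
qed

lemma ordering_cong:
  assumes "finite t" "\<And>a b. a \<in> t \<Longrightarrow> b \<in> t \<Longrightarrow> f a \<le> f b \<longleftrightarrow> g a \<le> g b"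
  shows "ordering f t = ordering g t"
  unfolding ordering_def using assms by (intro sort_key_cong_order) auto

text \<open>The result is one of six lists, selected by comparisons between measurable
  coordinates.\<close>

lemma measurable_ordering_triple:
  assumes "card t = 3" and m: "\<And>a. a \<in> t \<Longrightarrow> (\<lambda>\<omega>. X \<omega> a) \<in> borel_measurable M"
  shows "(\<lambda>\<omega>. ordering (X \<omega>) t) \<in> measurable M (count_space UNIV)"
proof -
  have fin: "finite t" using assms(1) by (auto intro: card_ge_0_finite)
  have "\<exists>p q r. xs = [p, q, r]" if "length xs = 3" for xs :: "nat list"
    using that by (auto simp: numeral_3_eq_3 length_Suc_conv)
  from this[of "sorted_list_of_set t"] obtain p q r where l: "sorted_list_of_set t = [p, q, r]"
    using assms(1) by auto
  then have "p \<in> t" "q \<in> t" "r \<in> t"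
    using set_sorted_list_of_set[OF fin] by auto
  note [measurable] = this[THEN m]
  have "ordering f t = (if f q \<le> f r then (if f p \<le> f q then [p, q, r] else if f p \<le> f r then [q, p, r] else [q, r, p])
      else (if f p \<le> f r then [p, r, q] else if f p \<le> f q then [r, p, q] else [r, q, p]))" for f
    by (simp add: ordering_def l)
  then show ?thesis by simp
qed

text \<open>For \<open>p = (X a + X b - 2 * X k, X a - X b)\<close> these are twice the utilities relative to \<open>X k\<close>.\<close>

definition triple_utility :: "nat \<Rightarrow> nat \<Rightarrow> real \<times> real \<Rightarrow> nat \<Rightarrow> real" where
  "triple_utility a b p m = (if m = a then fst p + snd p else if m = b then fst p - snd p else 0)"

lemma measurable_ordering_triple_utility:
  assumes "card t = 3"
  shows "(\<lambda>p. ordering (triple_utility a b p) t) \<in> measurable (borel \<Otimes>\<^sub>M borel) (count_space UNIV)"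
  using assms by (rule measurable_ordering_triple) (simp add: triple_utility_def)

text \<open>Equal variances of \<open>X a - X k\<close> and \<open>X b - X k\<close> make the forms
  \<open>u\<close> and \<open>d\<close>, which stand for \<open>X a + X b - 2 * X k\<close> and
  \<open>X a - X b\<close>, orthogonal and so independent, with variances \<open>4 * v - w\<close>
  and \<open>w\<close>. These two forms determine every comparison within the triple.\<close>

lemma choice_order_triple:
  fixes S :: "nat \<Rightarrow> nat \<Rightarrow> real"
  assumes gram: "\<And>a b. a < n \<Longrightarrow> b < n \<Longrightarrow> (\<Sum>k<n. A a k * A b k) = S a b"
    and lt: "a < n" "b < n" "k < n" and dist: "a \<noteq> b" "a \<noteq> k" "b \<noteq> k"
    and ab: "S a a + S b b - 2 * S a b = w"
    and ak: "S a a + S k k - 2 * S a k = v" and bk: "S b b + S k k - 2 * S b k = v"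
    and vw: "4 * v - w > 0"
  shows "choice_order n (\<lambda>_. 0) S {a, b, k} = distr (std_normal \<Otimes>\<^sub>M std_normal) (count_space UNIV)
    (\<lambda>(x, y). ordering (triple_utility a b (x, sqrt (w / (4 * v - w)) * y)) {a, b, k})"
    (is "_ = ?R")
proof -
  define F where "F = sqrt_factor n S"
  have F: "(\<Sum>k<n. F a k * F b k) = S a b" if "a < n" "b < n" for a b
    unfolding F_def using gram that by (rule sqrt_factor_gram)
  define u where "u = (\<lambda>l. F a l + F b l - 2 * F k l)"
  define d where "d = (\<lambda>l. F a l - F b l)"
  have Saa: "S b a = S a b" "S k a = S a k" "S k b = S b k"
    using lt by (simp_all add: mult.commute flip: F)
  have uu: "(\<Sum>l<n. (u l)\<^sup>2) = 4 * v - w"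
  proof -
    have "(\<Sum>l<n. (u l)\<^sup>2) = (\<Sum>l<n. F a l * F a l + F b l * F b l + 4 * (F k l * F k l) + 2 * (F a l * F b l)
        - 4 * (F a l * F k l) - 4 * (F b l * F k l))"
      by (simp add: u_def power2_eq_square algebra_simps)
    also have "\<dots> = S a a + S b b + 4 * S k k + 2 * S a b - 4 * S a k - 4 * S b k"
      using lt by (simp add: sum.distrib sum_subtractf F flip: sum_distrib_left)
    finally show ?thesis using ab ak bk by simp
  qed
  have dd: "(\<Sum>l<n. (d l)\<^sup>2) = w"
  proof -
    have "(\<Sum>l<n. (d l)\<^sup>2) = (\<Sum>l<n. F a l * F a l + F b l * F b l - 2 * (F a l * F b l))"
      by (simp add: d_def power2_eq_square algebra_simps)
    also have "\<dots> = w"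
      using lt ab by (simp add: sum.distrib sum_subtractf F flip: sum_distrib_left)
    finally show ?thesis .
  qed
  have ud: "(\<Sum>l<n. u l * d l) = 0"
  proof -
    have "(\<Sum>l<n. u l * d l) = (\<Sum>l<n. F a l * F a l - F b l * F b l - 2 * (F a l * F k l) + 2 * (F b l * F k l))"
      by (simp add: u_def d_def algebra_simps)
    also have "\<dots> = S a a - S b b - 2 * S a k + 2 * S b k"
      using lt by (simp add: sum.distrib sum_subtractf F flip: sum_distrib_left)
    finally show ?thesis using ak bk by simp
  qed
  have card3: "card {a, b, k} = 3"
    using dist by simp
  note m [measurable] = measurable_ordering_triple_utility[OF card3, of a b]
  define X where "X = (\<lambda>Z::nat \<Rightarrow> real. \<lambda>m\<in>{0..<n}. 0 + (\<Sum>l<n. F m l * Z l))"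
  have X [measurable]: "X \<in> measurable (std_gauss n) (PiM {0..<n} (\<lambda>_. borel))"
    unfolding X_def by measurable
  have ordm [measurable]: "(\<lambda>X. ordering X {a, b, k}) \<in> measurable (PiM {0..<n} (\<lambda>_. borel)) (count_space UNIV)"
    using lt by (intro measurable_ordering_triple[OF card3]) auto
  have ord: "ordering (X Z) {a, b, k} = ordering (triple_utility a b (\<Sum>l<n. u l * Z l, \<Sum>l<n. d l * Z l)) {a, b, k}" for Z
  proof (rule ordering_cong)
    have "(\<Sum>l<n. u l * Z l) = (\<Sum>l<n. F a l * Z l) + (\<Sum>l<n. F b l * Z l) - 2 * (\<Sum>l<n. F k l * Z l)"
      by (simp add: u_def algebra_simps sum.distrib sum_subtractf sum_distrib_left)
    moreover have "(\<Sum>l<n. d l * Z l) = (\<Sum>l<n. F a l * Z l) - (\<Sum>l<n. F b l * Z l)"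
      by (simp add: d_def algebra_simps sum_subtractf)
    ultimately show "X Z p \<le> X Z q \<longleftrightarrow> triple_utility a b (\<Sum>l<n. u l * Z l, \<Sum>l<n. d l * Z l) p
        \<le> triple_utility a b (\<Sum>l<n. u l * Z l, \<Sum>l<n. d l * Z l) q" if "p \<in> {a, b, k}" "q \<in> {a, b, k}" for p q
      using that lt dist by (auto simp: X_def triple_utility_def)
  qed simp
  \<comment> \<open>Dividing all utilities by the positive number \<open>sqrt (4 * v - w)\<close>
    changes no comparison and leaves only the ratio of the two deviations.\<close>
  have scale: "ordering (triple_utility a b (sqrt (4 * v - w) * x, sqrt w * y)) {a, b, k} =
      ordering (triple_utility a b (x, sqrt (w / (4 * v - w)) * y)) {a, b, k}" for x y
  proof (rule ordering_cong)
    have "triple_utility a b (sqrt (4 * v - w) * x, sqrt w * y) m =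
        sqrt (4 * v - w) * triple_utility a b (x, sqrt (w / (4 * v - w)) * y) m" for m
      using vw by (simp add: triple_utility_def real_sqrt_divide algebra_simps)
    then show "triple_utility a b (sqrt (4 * v - w) * x, sqrt w * y) p \<le> triple_utility a b (sqrt (4 * v - w) * x, sqrt w * y) q \<longleftrightarrow>
        triple_utility a b (x, sqrt (w / (4 * v - w)) * y) p \<le> triple_utility a b (x, sqrt (w / (4 * v - w)) * y) q" for p q
      using vw by simp
  qed simp
  have eq: "choice_order n (\<lambda>_. 0) S {a, b, k} = distr (std_gauss n) (count_space UNIV) (\<lambda>Z. ordering (X Z) {a, b, k})"
    unfolding choice_order_def gauss_def F_def[symmetric] X_def[symmetric]
    by (subst distr_distr) (auto simp: comp_def)
  show ?thesis
  proof (rule measure_eqI)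
    show "sets (choice_order n (\<lambda>_. 0) S {a, b, k}) = sets ?R"
      by (simp add: eq)
    fix E :: "nat list set"
    define f :: "real \<times> real \<Rightarrow> ennreal" where "f = (\<lambda>p. indicator E (ordering (triple_utility a b p) {a, b, k}))"
    have f [measurable]: "f \<in> borel_measurable (borel \<Otimes>\<^sub>M borel)"
      unfolding f_def by measurable
    have "emeasure (choice_order n (\<lambda>_. 0) S {a, b, k}) E =
        (\<integral>\<^sup>+L. indicator E L \<partial>distr (std_gauss n) (count_space UNIV) (\<lambda>Z. ordering (X Z) {a, b, k}))"
      by (simp add: eq)
    also have "\<dots> = (\<integral>\<^sup>+Z. f (\<Sum>l<n. u l * Z l, \<Sum>l<n. d l * Z l) \<partial>std_gauss n)"
      by (subst nn_integral_distr) (auto simp: ord f_def)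
    also have "\<dots> = (\<integral>\<^sup>+x. \<integral>\<^sup>+y. f (sqrt (4 * v - w) * x, sqrt w * y) \<partial>std_normal \<partial>std_normal)"
      using orthogonal_linear_forms_nn_integral[OF _ ud f] vw by (simp add: uu dd)
    also have "\<dots> = (\<integral>\<^sup>+x. \<integral>\<^sup>+y. f (x, sqrt (w / (4 * v - w)) * y) \<partial>std_normal \<partial>std_normal)"
      by (simp only: f_def scale)
    also have "\<dots> = (\<integral>\<^sup>+p. f (fst p, sqrt (w / (4 * v - w)) * snd p) \<partial>(std_normal \<Otimes>\<^sub>M std_normal))"
      by (simp add: std_normal.nn_integral_fst[symmetric])
    also have "\<dots> = (\<integral>\<^sup>+L. indicator E L \<partial>?R)"
      by (subst nn_integral_distr) (auto simp: f_def case_prod_beta)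
    also have "\<dots> = emeasure ?R E"
      by simp
    finally show "emeasure (choice_order n (\<lambda>_. 0) S {a, b, k}) E = emeasure ?R E" .
  qed
qed

section \<open>Covariances with one correlated pair\<close>

lemma det_eq_0_iff_kernel_to_mat:
  "det (to_mat n A) = 0 \<longleftrightarrow> (\<exists>x. (\<exists>b<n. x b \<noteq> 0) \<and> (\<forall>a<n. (\<Sum>b<n. A a b * x b) = 0))"
proof -
  have c: "to_mat n A \<in> carrier_mat n n"
    by (simp add: to_mat_def)
  have mv: "to_mat n A *\<^sub>v v = 0\<^sub>v n \<longleftrightarrow> (\<forall>a<n. (\<Sum>b<n. A a b * v $ b) = 0)"
    if "v \<in> carrier_vec n" for v
    using that by (auto simp: to_mat_def vec_eq_iff scalar_prod_def lessThan_atLeast0)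
  have nz: "v \<noteq> 0\<^sub>v n \<longleftrightarrow> (\<exists>b<n. v $ b \<noteq> 0)" if "v \<in> carrier_vec n" for v :: "real vec"
    using that by (auto simp: vec_eq_iff)
  show ?thesis
    unfolding det_0_iff_vec_prod_zero_field[OF c]
  proof
    assume "\<exists>v. v \<in> carrier_vec n \<and> v \<noteq> 0\<^sub>v n \<and> to_mat n A *\<^sub>v v = 0\<^sub>v n"
    then show "\<exists>x. (\<exists>b<n. x b \<noteq> 0) \<and> (\<forall>a<n. (\<Sum>b<n. A a b * x b) = 0)"
      using mv nz by blast
  next
    assume "\<exists>x. (\<exists>b<n. x b \<noteq> 0) \<and> (\<forall>a<n. (\<Sum>b<n. A a b * x b) = 0)"
    then obtain x where x: "\<exists>b<n. x b \<noteq> 0" "\<forall>a<n. (\<Sum>b<n. A a b * x b) = 0"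
      by blast
    have "vec n x \<in> carrier_vec n" by simp
    moreover have "vec n x \<noteq> 0\<^sub>v n"
      using x(1) by (subst nz) auto
    moreover have "to_mat n A *\<^sub>v vec n x = 0\<^sub>v n"
      using x(2) by (subst mv) auto
    ultimately show "\<exists>v. v \<in> carrier_vec n \<and> v \<noteq> 0\<^sub>v n \<and> to_mat n A *\<^sub>v v = 0\<^sub>v n"
      by blast
  qed
qed

text \<open>A Gram form is a squared length; this yields semidefiniteness and, in the rank
  computation, controls the kernel.\<close>

lemma gram_quadratic_form:
  fixes A :: "nat \<Rightarrow> nat \<Rightarrow> real"
  shows "(\<Sum>a<n. \<Sum>b<n. x a * (\<Sum>k<n. A a k * A b k) * x b) = (\<Sum>k<n. (\<Sum>a<n. x a * A a k)\<^sup>2)"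
proof -
  have "(\<Sum>a<n. \<Sum>b<n. x a * (\<Sum>k<n. A a k * A b k) * x b) =
      (\<Sum>a<n. \<Sum>b<n. \<Sum>k<n. (x a * A a k) * (x b * A b k))"
    by (simp add: sum_distrib_left sum_distrib_right algebra_simps)
  also have "\<dots> = (\<Sum>a<n. \<Sum>k<n. \<Sum>b<n. (x a * A a k) * (x b * A b k))"
    by (intro sum.cong refl sum.swap)
  also have "\<dots> = (\<Sum>k<n. \<Sum>a<n. \<Sum>b<n. (x a * A a k) * (x b * A b k))"
    by (rule sum.swap)
  also have "\<dots> = (\<Sum>k<n. (\<Sum>a<n. x a * A a k)\<^sup>2)"
    by (simp add: power2_eq_square sum_product)
  finally show ?thesis .
qed

text \<open>Adding the all-ones matrix, which has rank one, makes the matrix nonsingular.\<close>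

lemma mat_rank_centered_gram:
  fixes A :: "nat \<Rightarrow> nat \<Rightarrow> real"
  assumes "n > 0" and center: "\<And>k. k < n \<Longrightarrow> (\<Sum>a<n. A a k) = 0"
    and inj: "\<And>x. (\<Sum>a<n. x a) = 0 \<Longrightarrow> (\<And>k. k < n \<Longrightarrow> (\<Sum>a<n. x a * A a k) = 0) \<Longrightarrow> (\<And>a. a < n \<Longrightarrow> x a = 0)"
  shows "mat_rank n (\<lambda>a b. \<Sum>k<n. A a k * A b k) = n - 1"
proof -
  define S where "S = (\<lambda>a b. \<Sum>k<n. A a k * A b k)"
  interpret vec_space "TYPE(real)" n .
  have c: "to_mat n B \<in> carrier_mat n n" for B
    by (simp add: to_mat_def)
  \<comment> \<open>The constant vector lies in the kernel, which caps the rank at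
    \<open>n - 1\<close>.\<close>
  have "(\<Sum>b<n. S a b * 1) = 0" if "a < n" for a
  proof -
    have "(\<Sum>b<n. S a b) = (\<Sum>k<n. A a k * (\<Sum>b<n. A b k))"
      unfolding S_def by (subst sum.swap) (simp add: sum_distrib_left)
    then show ?thesis by (simp add: center)
  qed
  then have "det (to_mat n S) = 0"
    unfolding det_eq_0_iff_kernel_to_mat using \<open>n > 0\<close> by (intro exI[of _ "\<lambda>_. 1"]) auto
  then have "rank (to_mat n S) < n"
    using det_zero_low_rank[OF c] by blast
  moreover have "det (to_mat n (\<lambda>a b. S a b + 1)) \<noteq> 0"
  proof
    assume "det (to_mat n (\<lambda>a b. S a b + 1)) = 0"
    then obtain x where x: "\<exists>b<n. x b \<noteq> 0" "\<And>a. a < n \<Longrightarrow> (\<Sum>b<n. (S a b + 1) * x b) = 0"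
      unfolding det_eq_0_iff_kernel_to_mat by blast
    \<comment> \<open>Pairing the kernel equation with \<open>x\<close> itself gives a sum of
      squares equal to zero. So \<open>x\<close> has sum zero and is orthogonal to every column of
      \<open>A\<close>, and \<open>inj\<close> makes it vanish.\<close>
    have "0 = (\<Sum>a<n. x a * (\<Sum>b<n. (S a b + 1) * x b))"
      using x(2) by simp
    also have "\<dots> = (\<Sum>a<n. \<Sum>b<n. x a * S a b * x b) + (\<Sum>a<n. x a) * (\<Sum>a<n. x a)"
    proof -
      have "x a * (\<Sum>b<n. (S a b + 1) * x b) = (\<Sum>b<n. x a * S a b * x b) + x a * (\<Sum>b<n. x b)" for a
        by (simp add: distrib_left distrib_right sum.distrib sum_distrib_left mult.assoc)
      then show ?thesis by (simp add: sum.distrib sum_distrib_right)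
    qed
    also have "\<dots> = (\<Sum>k<n. (\<Sum>a<n. x a * A a k)\<^sup>2) + (\<Sum>a<n. x a)\<^sup>2"
      unfolding S_def gram_quadratic_form by (simp add: power2_eq_square)
    finally have z: "(\<Sum>k<n. (\<Sum>a<n. x a * A a k)\<^sup>2) + (\<Sum>a<n. x a)\<^sup>2 = 0" by simp
    have "(\<Sum>k<n. (\<Sum>a<n. x a * A a k)\<^sup>2) \<ge> 0" by (simp add: sum_nonneg)
    then have "(\<Sum>a<n. x a)\<^sup>2 = 0" "(\<Sum>k<n. (\<Sum>a<n. x a * A a k)\<^sup>2) = 0"
      using z zero_le_power2[of "\<Sum>a<n. x a"] by linarith+
    then have "(\<Sum>a<n. x a) = 0" "\<And>k. k < n \<Longrightarrow> (\<Sum>a<n. x a * A a k) = 0"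
      by (auto simp: sum_nonneg_eq_0_iff)
    with inj x(1) show False by blast
  qed
  then have "rank (to_mat n (\<lambda>a b. S a b + 1)) = n"
    using det_rank_iff[OF c] by blast
  moreover have "to_mat n (\<lambda>a b. S a b + 1) = to_mat n S + to_mat n (\<lambda>_ _. 1)"
    by (auto simp: to_mat_def)
  moreover have "rank (to_mat n (\<lambda>_ _. 1)) \<le> 1"
    by (rule rank_le_1_product_entries[OF c, where f = "\<lambda>_. 1" and g = "\<lambda>_. 1"]) (auto simp: to_mat_def)
  ultimately show ?thesis
    using rank_subadditive[OF c c, of S "\<lambda>_ _. 1"] unfolding mat_rank_def S_def[symmetric] by simp
qed

section \<open>The family of centered covariances with one correlated pair\<close>

text \<open>Double centering: removing the column means of the factor \<open>R\<close> multiplies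
  its Gram matrix by the centering projection on both sides.\<close>

lemma centered_gram:
  fixes R :: "nat \<Rightarrow> nat \<Rightarrow> real" and n :: nat
  defines "G \<equiv> \<lambda>a b. \<Sum>k<n. R a k * R b k"
  shows "(\<Sum>k<n. (R a k - (\<Sum>l<n. R l k) / n) * (R b k - (\<Sum>l<n. R l k) / n)) =
    G a b - (\<Sum>l<n. G a l) / n - (\<Sum>l<n. G l b) / n + (\<Sum>l<n. \<Sum>m<n. G l m) / n\<^sup>2"
proof -
  define M where "M k = (\<Sum>l<n. R l k)" for k
  have 1: "(\<Sum>l<n. G a l) = (\<Sum>k<n. R a k * M k)" for a
    unfolding G_def M_def by (subst sum.swap) (simp add: sum_distrib_left)
  have 2: "(\<Sum>l<n. G l b) = (\<Sum>k<n. M k * R b k)" for b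
    unfolding G_def M_def by (subst sum.swap) (simp add: sum_distrib_right)
  have 3: "(\<Sum>l<n. \<Sum>m<n. G l m) = (\<Sum>k<n. M k * M k)"
    unfolding 1 by (subst sum.swap) (simp add: M_def sum_distrib_right)
  have "(\<Sum>k<n. (R a k - M k / n) * (R b k - M k / n)) =
    (\<Sum>k<n. R a k * R b k - R a k * M k / n - M k * R b k / n + M k * M k / n\<^sup>2)"
    by (intro sum.cong refl) (simp add: algebra_simps power2_eq_square)
  also have "\<dots> = G a b - (\<Sum>l<n. G a l) / n - (\<Sum>l<n. G l b) / n + (\<Sum>l<n. \<Sum>m<n. G l m) / n\<^sup>2"
    by (simp only: 1[of a] 2[of b] 3) (simp add: G_def sum.distrib sum_subtractf sum_divide_distrib)
  finally show ?thesis by (simp add: M_def)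
qed

text \<open>The lower triangular factor of the covariance of a standard Gaussian vector
  in which the coordinates \<open>i\<close> and \<open>j\<close> alone have been given correlation \<open>t\<close>.\<close>

definition pair_chol :: "nat \<Rightarrow> nat \<Rightarrow> real \<Rightarrow> nat \<Rightarrow> nat \<Rightarrow> real" where
  "pair_chol i j t a k = (if k = a then (if a = j then sqrt (1 - t\<^sup>2) else 1) else 0) +
     (if k = i then (if a = j then t else 0) else 0)"

text \<open>The outer test of each \<open>t\<close> term is on \<open>b\<close>, so that row sums
  collapse term by term.\<close>

definition pair_corr :: "nat \<Rightarrow> nat \<Rightarrow> real \<Rightarrow> nat \<Rightarrow> nat \<Rightarrow> real" where
  "pair_corr i j t a b = (if a = b then 1 else 0) +
     (if b = j then (if a = i then t else 0) else 0) + (if b = i then (if a = j then t else 0) else 0)"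

text \<open>The factor that brings the trace of the centered covariance to \<open>n\<close>.\<close>

definition pair_scale :: "nat \<Rightarrow> real \<Rightarrow> real" where
  "pair_scale n t = (real n)\<^sup>2 / ((real n)\<^sup>2 - real n - 2 * t)"

definition pair_factor :: "nat \<Rightarrow> nat \<Rightarrow> nat \<Rightarrow> real \<Rightarrow> nat \<Rightarrow> nat \<Rightarrow> real" where
  "pair_factor n i j t a k =
     sqrt (pair_scale n t) * (pair_chol i j t a k - (\<Sum>l<n. pair_chol i j t l k) / n)"

text \<open>Taking a Gram matrix as the definition gives semidefiniteness and an explicit square
  root at once; \<open>pair_cov_eq\<close> supplies the entries.\<close>

definition pair_cov :: "nat \<Rightarrow> nat \<Rightarrow> nat \<Rightarrow> real \<Rightarrow> nat \<Rightarrow> nat \<Rightarrow> real" where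
  "pair_cov n i j t a b = (\<Sum>k<n. pair_factor n i j t a k * pair_factor n i j t b k)"

lemma pair_chol_gram:
  assumes "i < n" "i \<noteq> j" "\<bar>t\<bar> < 1" "a < n" "b < n"
  shows "(\<Sum>k<n. pair_chol i j t a k * pair_chol i j t b k) = pair_corr i j t a b"
proof -
  have t: "t\<^sup>2 \<le> 1" using assms(3) by (simp add: abs_square_le_1)
  \<comment> \<open>Row \<open>a\<close> of the factor is \<open>d a\<close> times the
    \<open>a\<close>-th unit vector plus \<open>e a\<close> times the \<open>i\<close>-th, so a
    product of two rows has four delta terms.\<close>
  define d e where "d a = (if a = j then sqrt (1 - t\<^sup>2) else 1)" and "e a = (if a = j then t else 0)" for a
  have "(\<Sum>k<n. pair_chol i j t a k * pair_chol i j t b k) =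
      (\<Sum>k<n. (if k = a then (if a = b then d a * d b else 0) else 0) + (if k = a then (if a = i then d a * e b else 0) else 0) +
        (if k = b then (if b = i then e a * d b else 0) else 0) + (if k = i then e a * e b else 0))"
    by (intro sum.cong refl) (auto simp: pair_chol_def d_def e_def algebra_simps)
  also have "\<dots> = (if a = b then d a * d b else 0) + (if a = i then d a * e b else 0) +
      (if b = i then e a * d b else 0) + e a * e b"
    using assms by (simp add: sum.distrib)
  also have "\<dots> = pair_corr i j t a b"
    using assms t by (auto simp: pair_corr_def d_def e_def power2_eq_square)
  finally show ?thesis .
qed

lemma pair_corr_row_sum:
  assumes "i < n" "j < n" "a < n"
  shows "(\<Sum>b<n. pair_corr i j t a b) = 1 + (if a = i then t else 0) + (if a = j then t else 0)"
  using assms by (simp add: pair_corr_def sum.distrib)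

lemma pair_corr_commute: "pair_corr i j t a b = pair_corr i j t b a"
  by (simp add: pair_corr_def)

lemma pair_corr_sum:
  assumes "i < n" "j < n"
  shows "(\<Sum>a<n. \<Sum>b<n. pair_corr i j t a b) = n + 2 * t"
  using assms by (simp add: pair_corr_row_sum sum.distrib)

lemma pair_scale_denom_pos:
  assumes "n \<ge> 3" "\<bar>t\<bar> < 1"
  shows "(real n)\<^sup>2 - real n - 2 * t > 0"
proof -
  have "real n * (real n - 1) \<ge> 3 * 2"
    using assms(1) by (intro mult_mono) auto
  then show ?thesis using assms(2) by (simp add: power2_eq_square algebra_simps)
qed

lemma pair_scale_pos: "n \<ge> 3 \<Longrightarrow> \<bar>t\<bar> < 1 \<Longrightarrow> pair_scale n t > 0"
  using pair_scale_denom_pos[of n t] by (simp add: pair_scale_def)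

lemma pair_cov_eq:
  assumes "n \<ge> 3" "i < n" "j < n" "i \<noteq> j" "\<bar>t\<bar> < 1" "a < n" "b < n"
  shows "pair_cov n i j t a b = pair_scale n t * (pair_corr i j t a b
    - (1 + (if a = i then t else 0) + (if a = j then t else 0)) / n
    - (1 + (if b = i then t else 0) + (if b = j then t else 0)) / n + (n + 2 * t) / n\<^sup>2)"
proof -
  have s: "(sqrt (pair_scale n t) * x) * (sqrt (pair_scale n t) * y) = pair_scale n t * (x * y)" for x y
  proof -
    have "(sqrt (pair_scale n t) * x) * (sqrt (pair_scale n t) * y) = (sqrt (pair_scale n t))\<^sup>2 * (x * y)"
      by (simp only: power2_eq_square mult_ac)
    then show ?thesis
      using pair_scale_pos[of n t] assms by simp
  qed
  have "pair_cov n i j t a b = pair_scale n t *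
      (\<Sum>k<n. (pair_chol i j t a k - (\<Sum>l<n. pair_chol i j t l k) / n) *
             (pair_chol i j t b k - (\<Sum>l<n. pair_chol i j t l k) / n))"
    by (simp only: pair_cov_def pair_factor_def s sum_distrib_left)
  also have "\<dots> = pair_scale n t * (pair_corr i j t a b - (\<Sum>l<n. pair_corr i j t a l) / n
      - (\<Sum>l<n. pair_corr i j t l b) / n + (\<Sum>l<n. \<Sum>m<n. pair_corr i j t l m) / n\<^sup>2)"
    unfolding centered_gram using assms by (simp add: pair_chol_gram)
  also have "(\<Sum>l<n. pair_corr i j t l b) = (\<Sum>l<n. pair_corr i j t b l)"
    by (intro sum.cong refl pair_corr_commute)
  finally show ?thesis
    using assms by (simp add: pair_corr_row_sum pair_corr_sum)
qed

text \<open>Centering subtracts the same random amount from every coordinate and cancels in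
  differences. Up to the common scale, the variances of differences remain those of the uncentered
  vector.\<close>

lemma pair_cov_variogram:
  assumes "n \<ge> 3" "i < n" "j < n" "i \<noteq> j" "\<bar>t\<bar> < 1" "a < n" "b < n" "a \<noteq> b"
  shows "pair_cov n i j t a a + pair_cov n i j t b b - 2 * pair_cov n i j t a b =
    pair_scale n t * (2 - 2 * pair_corr i j t a b)"
proof -
  have "pair_corr i j t a a = 1" "pair_corr i j t b b = 1"
    using assms by (auto simp: pair_corr_def)
  then show ?thesis
    using assms by (simp add: pair_cov_eq algebra_simps)
qed

lemma pair_factor_center:
  assumes "n > 0"
  shows "(\<Sum>a<n. pair_factor n i j t a k) = 0"
  using assms by (simp add: pair_factor_def sum_subtractf flip: sum_distrib_left)

text \<open>Before scaling, the centered covariance has trace \<open>n - 1 - 2 * t / n\<close>, and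
  \<open>pair_scale n t\<close> is \<open>n\<close> divided by this number.\<close>

lemma pair_cov_trace:
  assumes "n \<ge> 3" "i < n" "j < n" "i \<noteq> j" "\<bar>t\<bar> < 1"
  shows "mat_trace n (pair_cov n i j t) = n"
proof -
  have "mat_trace n (pair_cov n i j t) = pair_scale n t * (\<Sum>a<n. pair_corr i j t a a -
    2 / n * (1 + (if a = i then t else 0) + (if a = j then t else 0)) + (n + 2 * t) / n\<^sup>2)"
    unfolding mat_trace_def sum_distrib_left
  proof (intro sum.cong refl)
    fix a assume "a \<in> {..<n}"
    then have a: "a < n" by simp
    have "c * (K - q / n - q / n + r) = c * (K - 2 / n * q + r)" for c K q r :: real
      by (simp add: algebra_simps)
    then show "pair_cov n i j t a a = pair_scale n t * (pair_corr i j t a a -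
      2 / n * (1 + (if a = i then t else 0) + (if a = j then t else 0)) + (n + 2 * t) / n\<^sup>2)"
      by (simp only: pair_cov_eq[OF assms a a] of_nat_power)
  qed
  also have "(\<Sum>a<n. pair_corr i j t a a -
    2 / n * (1 + (if a = i then t else 0) + (if a = j then t else 0)) + (n + 2 * t) / n\<^sup>2) =
    (\<Sum>a<n. pair_corr i j t a a) - 2 / n * (\<Sum>a<n. 1 + (if a = i then t else 0) + (if a = j then t else 0)) + n * ((n + 2 * t) / n\<^sup>2)"
  proof -
    have "(\<Sum>a<n. p a - c * q a + r) = (\<Sum>a<n. p a) - c * (\<Sum>a<n. q a) + n * r" for p q c and r :: real
      by (simp add: sum.distrib sum_subtractf sum_distrib_left)
    then show ?thesis .
  qed
  also have "(\<Sum>a<n. pair_corr i j t a a) = (\<Sum>a<n. 1)"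
    using assms by (intro sum.cong refl) (auto simp: pair_corr_def)
  also have "(\<Sum>a<n. 1 + (if a = i then t else 0) + (if a = j then t else 0)) = n + 2 * t"
    using assms by (simp add: sum.distrib)
  also have "pair_scale n t * ((\<Sum>a<n. 1) - 2 / n * (n + 2 * t) + n * ((n + 2 * t) / n\<^sup>2)) = n"
  proof -
    have "(\<Sum>a<n. 1) - 2 / n * (n + 2 * t) + n * ((n + 2 * t) / n\<^sup>2) = ((real n)\<^sup>2 - real n - 2 * t) / n"
      using assms(1) by (simp add: field_simps power2_eq_square)
    then show ?thesis
      using pair_scale_denom_pos[of n t] assms unfolding pair_scale_def by (simp add: power2_eq_square)
  qed
  finally show ?thesis .
qed

text \<open>On vectors of sum zero the centering term drops out and leaves a triangular system with
  nonzero diagonal. Column \<open>j\<close> gives \<open>x j = 0\<close> first, and then every other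
  column gives its own entry.\<close>

lemma pair_factor_injective:
  assumes "n \<ge> 3" "i < n" "j < n" "i \<noteq> j" "\<bar>t\<bar> < 1"
    and sum0: "(\<Sum>a<n. x a) = 0" and orth: "\<And>k. k < n \<Longrightarrow> (\<Sum>a<n. x a * pair_factor n i j t a k) = 0"
    and "a < n"
  shows "x a = 0"
proof -
  have t: "sqrt (1 - t\<^sup>2) \<noteq> 0"
    using assms(5) by (simp add: abs_square_eq_1)
  have *: "x k * (if k = j then sqrt (1 - t\<^sup>2) else 1) + (if k = i then x j * t else 0) = 0" if "k < n" for k
  proof -
    define m where "m = (\<Sum>l<n. pair_chol i j t l k) / n"
    have "(\<Sum>a<n. x a * pair_factor n i j t a k) = sqrt (pair_scale n t) *
        ((\<Sum>a<n. x a * pair_chol i j t a k) - (\<Sum>a<n. x a) * m)"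
      unfolding pair_factor_def m_def[symmetric]
      by (simp add: sum_distrib_left sum_distrib_right sum_subtractf algebra_simps)
    then have "(\<Sum>a<n. x a * pair_chol i j t a k) = 0"
      using orth[OF that] sum0 pair_scale_pos[of n t] assms by simp
    also have "(\<Sum>a<n. x a * pair_chol i j t a k) =
        (\<Sum>a<n. (if a = k then x k * (if k = j then sqrt (1 - t\<^sup>2) else 1) else 0) + (if a = j then (if k = i then x j * t else 0) else 0))"
      by (intro sum.cong refl) (auto simp: pair_chol_def algebra_simps)
    also have "\<dots> = x k * (if k = j then sqrt (1 - t\<^sup>2) else 1) + (if k = i then x j * t else 0)"
      using that assms by (simp add: sum.distrib)
    finally show ?thesis .
  qed
  have "x j = 0"
    using *[of j] assms t by simp
  then show ?thesis
    using *[OF \<open>a < n\<close>] t by (auto split: if_splits)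
qed

lemma pair_cov_normalized:
  assumes "n \<ge> 3" "i < n" "j < n" "i \<noteq> j" "\<bar>t\<bar> < 1"
  shows "normalized_cov n (pair_cov n i j t)"
proof -
  have "mat_rank n (pair_cov n i j t) = n - 1"
    unfolding pair_cov_def[abs_def]
  proof (rule mat_rank_centered_gram)
    show "n > 0" using assms by simp
    show "(\<Sum>a<n. pair_factor n i j t a k) = 0" for k
      using assms by (simp add: pair_factor_center)
  qed (use pair_factor_injective[OF assms] in blast)
  moreover have "sym_psd n (pair_cov n i j t)"
    unfolding sym_psd_def pair_cov_def gram_quadratic_form by (auto simp: mult.commute sum_nonneg)
  moreover have "(\<Sum>b<n. pair_cov n i j t a b) = 0" for a
    unfolding pair_cov_def
    by (subst sum.swap) (use assms in \<open>simp add: pair_factor_center flip: sum_distrib_left\<close>)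
  ultimately show ?thesis
    using pair_cov_trace[OF assms] by (simp add: normalized_cov_def)
qed

text \<open>The difference is exactly \<open>t * (Q / (D * (N - 1)))\<close>. Bounding
  \<open>D\<close> by its value at \<open>t = 0\<close> leaves a quotient in \<open>N\<close> that
  is at least 2/3, with equality at \<open>N = 3\<close>.\<close>

lemma pair_cov_separation:
  assumes "n \<ge> 3" "i < n" "j < n" "i \<noteq> j" "0 \<le> t" "t < 1"
  shows "pair_cov n i j t i j - pair_cov n i j 0 i j \<ge> 2 / 3 * t"
proof -
  define N where "N = real n"
  have N: "N \<ge> 3" using assms by (simp add: N_def)
  have D: "N\<^sup>2 - N - 2 * t > 0"
    using pair_scale_denom_pos[of n t] assms by (simp add: N_def)
  have e: "pair_cov n i j s i j = (s * (N\<^sup>2 - 2 * N + 2) - N) / (N\<^sup>2 - N - 2 * s)" if "0 \<le> s" "s < 1" for s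
  proof -
    have "pair_cov n i j s i j = pair_scale n s * (s - (1 + s) / n - (1 + s) / n + (n + 2 * s) / n\<^sup>2)"
      using assms that by (subst pair_cov_eq) (auto simp: pair_corr_def)
    also have "s - (1 + s) / n - (1 + s) / n + (n + 2 * s) / n\<^sup>2 = (s * (N\<^sup>2 - 2 * N + 2) - N) / N\<^sup>2"
      using N by (simp add: N_def divide_simps) (simp add: power2_eq_square algebra_simps)
    finally show ?thesis using N by (simp add: pair_scale_def N_def)
  qed
  define D where "D = N\<^sup>2 - N - 2 * t"
  define E where "E = t * (N\<^sup>2 - 2 * N + 2) - N"
  define Q where "Q = (N\<^sup>2 - 2 * N + 2) * (N - 1) - 2"
  have Dpos: "D * (N - 1) > 0"
    using D N by (simp add: D_def)
  \<comment> \<open>The inequality \<open>2 / 3 * ((N\<^sup>2 - N) * (N - 1)) \<le> Q\<close> in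
    factored form; the root \<open>N = 3\<close> is the extremal case.\<close>
  have "0 \<le> (N - 3) * ((N - 1)\<^sup>2 + 3)"
    using N by (intro mult_nonneg_nonneg) auto
  also have "\<dots> = 3 * Q - 2 * ((N\<^sup>2 - N) * (N - 1))"
    by (simp add: Q_def power2_eq_square algebra_simps)
  finally have "2 * ((N\<^sup>2 - N) * (N - 1)) \<le> 3 * Q"
    by simp
  moreover have "D * (N - 1) \<le> (N\<^sup>2 - N) * (N - 1)"
    using N assms by (intro mult_right_mono) (auto simp: D_def)
  ultimately have "2 / 3 * (D * (N - 1)) \<le> Q"
    by linarith
  then have "2 / 3 \<le> Q / (D * (N - 1))"
    using Dpos by (simp add: pos_le_divide_eq)
  then have "t * (2 / 3) \<le> t * (Q / (D * (N - 1)))"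
    using assms by (intro mult_left_mono) auto
  also have "\<dots> = (E * (N - 1) + D) / (D * (N - 1))"
    by (simp add: E_def D_def Q_def power2_eq_square algebra_simps)
  also have "\<dots> = E / D + 1 / (N - 1)"
    using Dpos N by (auto simp: add_divide_distrib)
  also have "E / D = pair_cov n i j t i j"
    using e[of t] assms by (simp add: D_def E_def)
  also have "1 / (N - 1) = - pair_cov n i j 0 i j"
  proof -
    have "N\<^sup>2 - N = N * (N - 1)"
      by (simp add: power2_eq_square algebra_simps)
    then show ?thesis using e[of 0] N by simp
  qed
  finally show ?thesis by simp
qed

section \<open>The lower bound\<close>

lemma abs_le_max_norm:
  assumes "a < n" "b < n"
  shows "\<bar>A a b\<bar> \<le> max_norm n A"
proof -
  have "{\<bar>A i j\<bar> | i j. i < n \<and> j < n} = (\<lambda>(i, j). \<bar>A i j\<bar>) ` ({..<n} \<times> {..<n})"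
    by auto
  then have "finite {\<bar>A i j\<bar> | i j. i < n \<and> j < n}"
    by simp
  then show ?thesis
    unfolding max_norm_def using assms by (intro Max_ge) auto
qed

lemma finite_triples: "finite (triples n)"
  unfolding triples_def by (rule finite_subset[of _ "Pow {0..<n}"]) auto

lemma sample_index_eq_Sigma: "sample_index n N = Sigma (triples n) (\<lambda>t. {..<N t})"
  by (auto simp: sample_index_def)

lemma finite_sample_index: "finite (sample_index n N)"
  unfolding sample_index_eq_Sigma by (intro finite_SigmaI finite_triples) auto

lemma triples_containing_pair:
  assumes "i < n" "j < n" "i \<noteq> j"
  shows "{t \<in> triples n. i \<in> t \<and> j \<in> t} = (\<lambda>k. {i, j, k}) ` ({0..<n} - {i, j})"
proof (intro equalityI subsetI)
  fix t assume "t \<in> {t \<in> triples n. i \<in> t \<and> j \<in> t}"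
  then have t: "t \<subseteq> {0..<n}" "card t = 3" "i \<in> t" "j \<in> t"
    by (auto simp: triples_def)
  then have "finite t" by (auto intro: finite_subset)
  then have "card (t - {i, j}) = 1"
    using t assms by (simp add: card_Diff_subset)
  then obtain k where k: "t - {i, j} = {k}"
    by (auto simp: card_1_singleton_iff)
  then have "t = {i, j, k}" "k \<in> {0..<n} - {i, j}"
    using t by auto
  then show "t \<in> (\<lambda>k. {i, j, k}) ` ({0..<n} - {i, j})"
    by blast
qed (use assms in \<open>auto simp: triples_def\<close>)

text \<open>The triples with both \<open>i\<close> and \<open>j\<close> correspond one to one to the
  third element \<open>k\<close>, and their sample counts add up to \<open>pair_count\<close>. This
  collapses the product of affinities to a power.\<close>

lemma prod_sample_index_pair:
  fixes b :: real
  assumes "i < n" "j < n" "i \<noteq> j"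
  shows "(\<Prod>(t, m)\<in>sample_index n N. if i \<in> t \<and> j \<in> t then b else 1) = b ^ pair_count n N i j"
proof -
  have "(\<Prod>(t, m)\<in>sample_index n N. if i \<in> t \<and> j \<in> t then b else 1) =
      (\<Prod>t\<in>triples n. \<Prod>m<N t. if i \<in> t \<and> j \<in> t then b else 1)"
    unfolding sample_index_eq_Sigma by (subst prod.Sigma) (auto simp: finite_triples)
  also have "\<dots> = (\<Prod>t\<in>triples n. if i \<in> t \<and> j \<in> t then b ^ N t else 1)"
    by (intro prod.cong) auto
  also have "\<dots> = (\<Prod>t\<in>{t \<in> triples n. i \<in> t \<and> j \<in> t}. b ^ N t)"
    by (simp add: prod.inter_filter finite_triples)
  also have "\<dots> = (\<Prod>k\<in>{0..<n} - {i, j}. b ^ N {i, j, k})"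
    unfolding triples_containing_pair[OF assms]
    by (subst prod.reindex) (auto simp: inj_on_def doubleton_eq_iff insert_eq_iff)
  also have "\<dots> = b ^ pair_count n N i j"
    by (simp add: pair_count_def power_sum)
  finally show ?thesis .
qed

text \<open>Here \<open>v = 2 * c\<close> and \<open>w = 2 * c * (1 - \<kappa>)\<close> with the
  normalizing scale \<open>c\<close>, which cancels in \<open>w / (4 * v - w)\<close>. Hence the
  dependence of the scale on \<open>s\<close> is invisible in the orderings.\<close>

lemma pair_cov_triple_law:
  assumes "n \<ge> 3" "i < n" "j < n" "i \<noteq> j" "\<bar>s\<bar> < 1"
    and lt: "a < n" "b < n" "k < n" and dist: "a \<noteq> b" "a \<noteq> k" "b \<noteq> k"
    and corr: "pair_corr i j s a k = 0" "pair_corr i j s b k = 0" "pair_corr i j s a b = \<kappa>" and "\<bar>\<kappa>\<bar> < 1"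
  shows "choice_order n (\<lambda>_. 0) (pair_cov n i j s) {a, b, k} =
    distr (std_normal \<Otimes>\<^sub>M std_normal) (count_space UNIV)
      (\<lambda>(x, y). ordering (triple_utility a b (x, sqrt ((1 - \<kappa>) / (3 + \<kappa>)) * y)) {a, b, k})"
proof -
  define c where "c = pair_scale n s"
  have c: "c > 0"
    using pair_scale_pos[of n s] assms by (simp add: c_def)
  have e: "4 * (c * (2 - 2 * 0)) - c * (2 - 2 * \<kappa>) = 2 * c * (3 + \<kappa>)"
    by (simp add: algebra_simps)
  have q: "c * (2 - 2 * \<kappa>) / (4 * (c * (2 - 2 * 0)) - c * (2 - 2 * \<kappa>)) = (1 - \<kappa>) / (3 + \<kappa>)"
  proof -
    have "c * (2 - 2 * \<kappa>) / (4 * (c * (2 - 2 * 0)) - c * (2 - 2 * \<kappa>)) = (2 * c * (1 - \<kappa>)) / (2 * c * (3 + \<kappa>))"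
      unfolding e by (simp add: algebra_simps)
    then show ?thesis using c by simp
  qed
  have "c * (3 + \<kappa>) > 0"
    using c assms by (intro mult_pos_pos) auto
  then have "4 * (c * (2 - 2 * 0)) - c * (2 - 2 * \<kappa>) > 0"
    unfolding e by simp
  with choice_order_triple[OF _ lt dist, where A = "pair_factor n i j s" and S = "pair_cov n i j s"
      and w = "c * (2 - 2 * \<kappa>)" and v = "c * (2 - 2 * 0)"]
  show ?thesis
    unfolding q using assms by (simp add: pair_cov_variogram c_def flip: pair_cov_def)
qed

text \<open>One map \<open>h\<close> serves both parameters: correlation zero gives the deviation
  ratio \<open>sqrt (1 / 3)\<close>, and passing to \<open>s\<close> only rescales \<open>y\<close>.
  A triple without both \<open>i\<close> and \<open>j\<close> has three uncorrelated pairs under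
  either parameter.\<close>

lemma pair_cov_triple_laws:
  assumes "n \<ge> 3" "i < n" "j < n" "i \<noteq> j" "0 \<le> s" "s < 1" "t \<in> triples n"
  shows "\<exists>h. h \<in> measurable (std_normal \<Otimes>\<^sub>M std_normal) (count_space UNIV) \<and>
    choice_order n (\<lambda>_. 0) (pair_cov n i j 0) t = distr (std_normal \<Otimes>\<^sub>M std_normal) (count_space UNIV) h \<and>
    choice_order n (\<lambda>_. 0) (pair_cov n i j s) t = distr (std_normal \<Otimes>\<^sub>M std_normal) (count_space UNIV)
      (\<lambda>(x, y). h (x, (if i \<in> t \<and> j \<in> t then sqrt (3 * (1 - s) / (3 + s)) else 1) * y))"
proof -
  \<comment> \<open>The elements are listed so that only the first two can be correlated.\<close>
  obtain a b k \<kappa> where t: "t = {a, b, k}" and lt: "a < n" "b < n" "k < n"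
    and dist: "a \<noteq> b" "a \<noteq> k" "b \<noteq> k"
    and corr: "pair_corr i j s a k = 0" "pair_corr i j s b k = 0" "pair_corr i j s a b = \<kappa>"
    and \<kappa>: "\<kappa> = (if i \<in> t \<and> j \<in> t then s else 0)"
  proof (cases "i \<in> t \<and> j \<in> t")
    case True
    then have "t \<in> (\<lambda>k. {i, j, k}) ` ({0..<n} - {i, j})"
      using assms(7) by (simp flip: triples_containing_pair[OF assms(2-4)])
    then obtain k where "t = {i, j, k}" "k \<in> {0..<n} - {i, j}"
      by blast
    then show ?thesis
      using that[of i j k s] assms by (auto simp: pair_corr_def)
  next
    case False
    obtain a b k where abk: "t = {a, b, k}" "a \<noteq> b" "a \<noteq> k" "b \<noteq> k"
      using assms(7) by (auto simp: triples_def card_3_iff)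
    then have "a < n" "b < n" "k < n"
      using assms(7) by (auto simp: triples_def)
    with abk False show ?thesis
      using that[of a b k 0] by (auto simp: pair_corr_def)
  qed
  have corr0: "pair_corr i j 0 a k = 0" "pair_corr i j 0 b k = 0" "pair_corr i j 0 a b = 0"
    using dist by (auto simp: pair_corr_def)
  have \<kappa>1: "0 \<le> \<kappa>" "\<kappa> < 1" using assms \<kappa> by auto
  define h where "h = (\<lambda>(x, y). ordering (triple_utility a b (x, sqrt (1 / 3) * y)) t)"
  have card3: "card t = 3" using dist t by simp
  note [measurable] = measurable_ordering_triple_utility[OF card3, of a b]
  have "h \<in> measurable (std_normal \<Otimes>\<^sub>M std_normal) (count_space UNIV)"
    unfolding h_def by measurable
  moreover have "choice_order n (\<lambda>_. 0) (pair_cov n i j 0) t = distr (std_normal \<Otimes>\<^sub>M std_normal) (count_space UNIV) h"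
    using pair_cov_triple_law[OF assms(1-4) _ lt dist corr0] by (simp add: t h_def)
  moreover have "choice_order n (\<lambda>_. 0) (pair_cov n i j s) t = distr (std_normal \<Otimes>\<^sub>M std_normal) (count_space UNIV)
      (\<lambda>(x, y). h (x, (if i \<in> t \<and> j \<in> t then sqrt (3 * (1 - s) / (3 + s)) else 1) * y))"
  proof -
    have "sqrt ((1 - \<kappa>) / (3 + \<kappa>)) = sqrt (1 / 3) * sqrt (3 * (1 - \<kappa>) / (3 + \<kappa>))"
      by (subst real_sqrt_mult[symmetric]) (use \<kappa>1 in \<open>simp add: field_simps\<close>)
    moreover have "(if i \<in> t \<and> j \<in> t then sqrt (3 * (1 - s) / (3 + s)) else 1) = sqrt (3 * (1 - \<kappa>) / (3 + \<kappa>))"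
      by (simp add: \<kappa>)
    ultimately show ?thesis
      using pair_cov_triple_law[OF assms(1-4) _ lt dist corr] \<kappa>1 assms
      by (simp add: t[symmetric] h_def mult.assoc)
  qed
  ultimately show ?thesis by blast
qed

text \<open>The fourth power clears both square roots: it equals
  \<open>1 - 16 * \<epsilon>\<^sup>2 / (4 - 2 * \<epsilon>)\<^sup>2\<close>, a loss of at most
  \<open>2 * \<epsilon>\<^sup>2\<close>, and \<open>exp (- x) \<le> 1 - x / 2\<close> at the small
  value \<open>x = 4 * \<epsilon>\<^sup>2\<close> absorbs it.\<close>

lemma pair_affinity_bound:
  fixes \<epsilon> :: real
  assumes "0 < \<epsilon>" "\<epsilon> < 1 / 16"
  defines "\<rho> \<equiv> sqrt (3 * (1 - 3 / 2 * \<epsilon>) / (3 + 3 / 2 * \<epsilon>))"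
  shows "\<rho> > 0" and "exp (- 4 * \<epsilon>\<^sup>2) \<le> (sqrt (2 * \<rho> / (1 + \<rho>\<^sup>2))) ^ 4"
proof -
  show \<rho>: "\<rho> > 0"
    unfolding \<rho>_def using assms by (intro real_sqrt_gt_zero divide_pos_pos) auto
  have \<rho>2: "\<rho>\<^sup>2 = (2 - 3 * \<epsilon>) / (2 + \<epsilon>)"
    unfolding \<rho>_def using assms(1,2) by (simp add: divide_simps) (simp add: algebra_simps)
  have "(sqrt (2 * \<rho> / (1 + \<rho>\<^sup>2))) ^ 4 = ((sqrt (2 * \<rho> / (1 + \<rho>\<^sup>2)))\<^sup>2)\<^sup>2"
    by simp
  also have "\<dots> = 4 * \<rho>\<^sup>2 / (1 + \<rho>\<^sup>2)\<^sup>2"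
    using \<rho> by (simp add: power_divide power_mult_distrib)
  also have "\<dots> = 4 * \<rho>\<^sup>2 / ((4 - 2 * \<epsilon>) / (2 + \<epsilon>))\<^sup>2"
  proof -
    have "1 + \<rho>\<^sup>2 = (4 - 2 * \<epsilon>) / (2 + \<epsilon>)"
      unfolding \<rho>2 using assms(1,2) by (simp add: field_simps)
    then show ?thesis by simp
  qed
  also have "\<dots> = 4 * ((2 - 3 * \<epsilon>) * (2 + \<epsilon>)) / (4 - 2 * \<epsilon>)\<^sup>2"
    unfolding \<rho>2 using assms by (simp add: power_divide power2_eq_square)
  also have "4 * ((2 - 3 * \<epsilon>) * (2 + \<epsilon>)) = (4 - 2 * \<epsilon>)\<^sup>2 - 16 * \<epsilon>\<^sup>2"
    by (simp add: power2_eq_square algebra_simps)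
  also have "((4 - 2 * \<epsilon>)\<^sup>2 - 16 * \<epsilon>\<^sup>2) / (4 - 2 * \<epsilon>)\<^sup>2 = 1 - 16 * \<epsilon>\<^sup>2 / (4 - 2 * \<epsilon>)\<^sup>2"
    using assms by (simp add: diff_divide_distrib)
  finally have eq: "(sqrt (2 * \<rho> / (1 + \<rho>\<^sup>2))) ^ 4 = 1 - 16 * \<epsilon>\<^sup>2 / (4 - 2 * \<epsilon>)\<^sup>2" .
  have "(4 - 2 * \<epsilon>)\<^sup>2 \<ge> 3\<^sup>2"
    using assms by (intro power_mono) auto
  \<comment> \<open>The bound 9 for the denominator is weakened to 8 to reach the round constant
    2.\<close>
  then have "16 * \<epsilon>\<^sup>2 / (4 - 2 * \<epsilon>)\<^sup>2 \<le> 16 * \<epsilon>\<^sup>2 / 8"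
    by (intro divide_left_mono) auto
  then have x: "16 * \<epsilon>\<^sup>2 / (4 - 2 * \<epsilon>)\<^sup>2 \<le> 2 * \<epsilon>\<^sup>2"
    by simp
  have "\<epsilon>\<^sup>2 \<le> (1 / 16)\<^sup>2"
    using assms by (intro power_mono) auto
  then have small: "\<epsilon>\<^sup>2 \<le> 1 / 4"
    by (simp add: power2_eq_square)
  have "exp (- 4 * \<epsilon>\<^sup>2) \<le> 1 - 2 * \<epsilon>\<^sup>2"
  proof -
    have "1 + 4 * \<epsilon>\<^sup>2 \<le> exp (4 * \<epsilon>\<^sup>2)"
      by (rule exp_ge_add_one_self)
    then have "exp (- (4 * \<epsilon>\<^sup>2)) \<le> 1 / (1 + 4 * \<epsilon>\<^sup>2)"
      unfolding exp_minus by (simp add: divide_simps add_pos_nonneg)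
    also have "\<dots> \<le> 1 - 2 * \<epsilon>\<^sup>2"
    proof -
      have "0 \<le> \<epsilon>\<^sup>2 * (2 - 8 * \<epsilon>\<^sup>2)"
        using small by (intro mult_nonneg_nonneg) auto
      then have "1 \<le> (1 - 2 * \<epsilon>\<^sup>2) * (1 + 4 * \<epsilon>\<^sup>2)"
        by (simp add: algebra_simps)
      then show ?thesis
        by (simp add: pos_divide_le_eq add_pos_nonneg)
    qed
    finally show ?thesis by simp
  qed
  then show "exp (- 4 * \<epsilon>\<^sup>2) \<le> (sqrt (2 * \<rho> / (1 + \<rho>\<^sup>2))) ^ 4"
    unfolding eq using x by linarith
qed

theorem theorem5:
  fixes n :: nat and \<delta> \<epsilon> :: real
    and N :: "nat set \<Rightarrow> nat"
    and T :: "(nat set \<times> nat \<Rightarrow> nat list) \<Rightarrow> (nat \<Rightarrow> nat \<Rightarrow> real)"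
  assumes "n \<ge> 3"
    and "0 < \<delta>" "\<delta> < 2 powr (-4)" and "0 < \<epsilon>" "\<epsilon> < 2 powr (-4)"
    and "\<exists>i j. i < n \<and> j < n \<and> i \<noteq> j \<and>
           real (pair_count n N i j) \<le> \<epsilon> powr (-2) * ln (1 / \<delta>) / 4"
  shows "\<exists>S1 S2. normalized_cov n S1 \<and> normalized_cov n S2 \<and>
           mat_trace n S1 = real n \<and> mat_trace n S2 = real n \<and>
           max_norm n (\<lambda>i j. S1 i j - S2 i j) \<ge> \<epsilon> \<and>
           max (measure (sample_law n N (\<lambda>_. 0) S1)
                  {X \<in> space (sample_law n N (\<lambda>_. 0) S1). max_norm n (\<lambda>i j. T X i j - S1 i j) \<ge> \<epsilon> / 4})
               (measure (sample_law n N (\<lambda>_. 0) S2)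
                  {X \<in> space (sample_law n N (\<lambda>_. 0) S2). max_norm n (\<lambda>i j. T X i j - S2 i j) \<ge> \<epsilon> / 4})
             \<ge> \<delta>"
proof -
  obtain i j where ij: "i < n" "j < n" "i \<noteq> j"
    and count: "real (pair_count n N i j) \<le> \<epsilon> powr (-2) * ln (1 / \<delta>) / 4"
    using assms(6) by blast
  have "2 powr (-4) = (1 / 16 :: real)"
    by (simp add: powr_minus divide_simps flip: powr_numeral)
  then have small: "\<delta> < 1 / 16" "\<epsilon> < 1 / 16"
    using assms by auto
  \<comment> \<open>The factor 3/2 offsets the 2/3 of \<open>pair_cov_separation\<close>, so the
    entries at \<open>(i, j)\<close> differ by at least \<open>\<epsilon>\<close>.\<close>
  define s where "s = 3 / 2 * \<epsilon>"
  have s: "0 \<le> s" "s < 1"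
    using assms small by (auto simp: s_def)
  define S1 S2 where "S1 = pair_cov n i j 0" and "S2 = pair_cov n i j s"
  have norm: "normalized_cov n S1" "normalized_cov n S2"
    unfolding S1_def S2_def using assms ij s by (auto intro!: pair_cov_normalized)
  have sep: "\<epsilon> \<le> S2 i j - S1 i j"
    using pair_cov_separation[OF assms(1) ij s] by (simp add: S1_def S2_def s_def)

  define \<rho> where "\<rho> = sqrt (3 * (1 - s) / (3 + s))"
  have \<rho>: "\<rho> > 0" "exp (- 4 * \<epsilon>\<^sup>2) \<le> (sqrt (2 * \<rho> / (1 + \<rho>\<^sup>2))) ^ 4"
    using pair_affinity_bound[OF assms(4) small(2)] by (simp_all add: \<rho>_def s_def)
  define r where "r t = (if i \<in> t \<and> j \<in> t then \<rho> else 1)" for t :: "nat set"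
  have r: "r t > 0" for t
    using \<rho> by (simp add: r_def)
  let ?\<nu> = "std_normal \<Otimes>\<^sub>M std_normal" and ?L = "count_space (UNIV :: nat list set)"
  \<comment> \<open>A measurable map is chosen for every \<open>t\<close>, a constant one outside
    \<open>triples n\<close>, because the two-point bound asks for measurability at every
    index.\<close>
  have "\<exists>h. h \<in> measurable ?\<nu> ?L \<and> (t \<in> triples n \<longrightarrow>
      choice_order n (\<lambda>_. 0) S1 t = distr ?\<nu> ?L h \<and>
      choice_order n (\<lambda>_. 0) S2 t = distr (density ?\<nu> (normal_scale_ratio (r t))) ?L h)" for t
  proof (cases "t \<in> triples n")
    case True
    from pair_cov_triple_laws[OF assms(1) ij s True] obtain h where
      h: "h \<in> measurable ?\<nu> ?L" "choice_order n (\<lambda>_. 0) S1 t = distr ?\<nu> ?L h"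
        "choice_order n (\<lambda>_. 0) S2 t = distr ?\<nu> ?L (\<lambda>(x, y). h (x, r t * y))"
      unfolding S1_def S2_def r_def \<rho>_def by auto
    then show ?thesis
      using distr_std_normal_pair_scale[OF r h(1)] by (intro exI[of _ h]) simp
  next
    case False
    then show ?thesis by (intro exI[of _ "\<lambda>_. []"]) simp
  qed
  then obtain h where h: "\<And>t. h t \<in> measurable ?\<nu> ?L"
    "\<And>t. t \<in> triples n \<Longrightarrow> choice_order n (\<lambda>_. 0) S1 t = distr ?\<nu> ?L (h t)"
    "\<And>t. t \<in> triples n \<Longrightarrow> choice_order n (\<lambda>_. 0) S2 t = distr (density ?\<nu> (normal_scale_ratio (r t))) ?L (h t)"
    by metis

  define I where "I = sample_index n N"
  define P where "P = sample_law n N (\<lambda>_. 0) S1"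
  define Q where "Q = sample_law n N (\<lambda>_. 0) S2"
  have P: "P = PiM I (\<lambda>p. distr ?\<nu> ?L (h (fst p)))"
    unfolding P_def sample_law_def I_def by (intro PiM_cong) (auto simp: sample_index_def h)
  have Q: "Q = PiM I (\<lambda>p. distr (density ?\<nu> (normal_scale_ratio (r (fst p)))) ?L (h (fst p)))"
    unfolding Q_def sample_law_def I_def by (intro PiM_cong) (auto simp: sample_index_def h)
  \<comment> \<open>The sample space carries the discrete sigma-algebra, so the error events are
    measurable whatever function \<open>T\<close> is.\<close>
  have cs: "PiM I (\<lambda>_. ?L) = count_space (PiE I (\<lambda>_. UNIV))"
    unfolding I_def by (rule count_space_PiM_finite) (auto simp: finite_sample_index)
  have space: "space P = PiE I (\<lambda>_. UNIV)" "space Q = PiE I (\<lambda>_. UNIV)"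
    unfolding P Q by (simp_all add: space_PiM)
  define E1 where "E1 = {X \<in> space P. max_norm n (\<lambda>i j. T X i j - S1 i j) \<ge> \<epsilon> / 4}"
  define E2 where "E2 = {X \<in> space Q. max_norm n (\<lambda>i j. T X i j - S2 i j) \<ge> \<epsilon> / 4}"
  \<comment> \<open>An estimate closer than \<open>\<epsilon> / 4\<close> to both covariances would
    put their entries at \<open>(i, j)\<close> within \<open>\<epsilon> / 2\<close> of each
    other.\<close>
  have cover: "X \<in> E1 \<union> E2" if "X \<in> PiE I (\<lambda>_. UNIV)" for X
  proof (rule ccontr)
    assume "X \<notin> E1 \<union> E2"
    then have "max_norm n (\<lambda>i j. T X i j - S1 i j) < \<epsilon> / 4" "max_norm n (\<lambda>i j. T X i j - S2 i j) < \<epsilon> / 4"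
      using that by (auto simp: E1_def E2_def space)
    then have "\<bar>T X i j - S1 i j\<bar> < \<epsilon> / 4" "\<bar>T X i j - S2 i j\<bar> < \<epsilon> / 4"
      using abs_le_max_norm[OF ij(1,2), of "\<lambda>i j. T X i j - S1 i j"]
        abs_le_max_norm[OF ij(1,2), of "\<lambda>i j. T X i j - S2 i j"] by auto
    with sep \<open>0 < \<epsilon>\<close> show False by linarith
  qed
  define b where "b = sqrt (2 * \<rho> / (1 + \<rho>\<^sup>2))"
  have b: "b > 0"
    using \<rho> by (simp add: b_def add_pos_nonneg)
  have "(\<Prod>p\<in>I. sqrt (2 * r (fst p) / (1 + (r (fst p))\<^sup>2)))\<^sup>2 / 2 \<le> measure P E1 + measure Q E2"
    unfolding P Q
  proof (rule product_two_point_bound)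
    show "finite I" by (simp add: I_def finite_sample_index)
    show "prob_space ?\<nu>" by (rule std_normal_pair.prob_space_axioms)
    show "E1 \<in> sets (PiM I (\<lambda>_. ?L))" "E2 \<in> sets (PiM I (\<lambda>_. ?L))" "space (PiM I (\<lambda>_. ?L)) \<subseteq> E1 \<union> E2"
      using cover by (auto simp: cs E1_def E2_def space)
    show "sqrt (2 * r (fst p) / (1 + (r (fst p))\<^sup>2)) > 0" for p :: "nat set \<times> nat"
      using r[of "fst p"] by (simp add: add_pos_nonneg)
  qed (auto simp: normal_scale_ratio_nonneg normal_scale_ratio_integral normal_scale_ratio_affinity r h)
  \<comment> \<open>A triple without both \<open>i\<close> and \<open>j\<close> has
    \<open>r = 1\<close>, hence affinity one.\<close>
  also have "(\<Prod>p\<in>I. sqrt (2 * r (fst p) / (1 + (r (fst p))\<^sup>2))) =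
      (\<Prod>(t, m)\<in>I. if i \<in> t \<and> j \<in> t then b else 1)"
    by (intro prod.cong) (auto simp: r_def b_def)
  also have "\<dots> = b ^ pair_count n N i j"
    unfolding I_def by (rule prod_sample_index_pair[OF ij])
  finally have le: "(b ^ pair_count n N i j)\<^sup>2 / 2 \<le> measure P E1 + measure Q E2" .

  \<comment> \<open>The sample bound says that \<open>4 * \<epsilon>\<^sup>2\<close> times the pair
    count is at most \<open>ln (1 / \<delta>)\<close>; with the bound on \<open>b ^ 4\<close> this
    puts \<open>\<delta>\<close> below the fourth power of the total affinity.\<close>
  have "\<delta> = exp (- ln (1 / \<delta>))"
    using assms by (simp add: ln_div)
  also have "\<dots> \<le> exp (- 4 * \<epsilon>\<^sup>2 * pair_count n N i j)"
  proof -
    have "4 * \<epsilon>\<^sup>2 * pair_count n N i j \<le> 4 * \<epsilon>\<^sup>2 * (\<epsilon> powr (-2) * ln (1 / \<delta>) / 4)"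
      using count by (intro mult_left_mono) auto
    also have "\<dots> = ln (1 / \<delta>)"
      using assms by (simp add: powr_minus field_simps)
    finally show ?thesis by simp
  qed
  also have "\<dots> = exp (- 4 * \<epsilon>\<^sup>2) ^ pair_count n N i j"
    by (simp add: exp_of_nat_mult[symmetric] mult.commute)
  also have "\<dots> \<le> (b ^ 4) ^ pair_count n N i j"
    using \<rho>(2) by (intro power_mono) (auto simp: b_def)
  also have "\<dots> = ((b ^ pair_count n N i j)\<^sup>2)\<^sup>2"
    by (simp add: mult.commute flip: power_mult)
  finally have "sqrt \<delta> \<le> (b ^ pair_count n N i j)\<^sup>2"
    by (rule real_le_lsqrt[rotated -1]) (use assms in auto)
  \<comment> \<open>This is where \<open>\<delta> < 1 / 16\<close> enters: half of
    \<open>sqrt \<delta>\<close> is still \<open>2 * \<delta>\<close>, so one of the two errors is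
    at least \<open>\<delta>\<close>.\<close>
  moreover have "4 * \<delta> \<le> sqrt \<delta>"
  proof -
    have "sqrt \<delta> \<le> sqrt ((1 / 4)\<^sup>2)"
      using small by (intro real_sqrt_le_mono) (simp add: power2_eq_square)
    then have "sqrt \<delta> * (4 * sqrt \<delta>) \<le> sqrt \<delta> * 1"
      using assms(2) by (intro mult_left_mono) auto
    moreover have "sqrt \<delta> * (4 * sqrt \<delta>) = 4 * \<delta>"
      using assms(2) by simp
    ultimately show ?thesis by simp
  qed
  ultimately have "2 * \<delta> \<le> measure P E1 + measure Q E2"
    using le by linarith
  then have "\<delta> \<le> max (measure P E1) (measure Q E2)"
    by linarith
  moreover have "\<epsilon> \<le> max_norm n (\<lambda>i j. S1 i j - S2 i j)"
    using abs_le_max_norm[OF ij(1,2), of "\<lambda>i j. S1 i j - S2 i j"] sep by linarith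
  ultimately show ?thesis
    using norm unfolding P_def Q_def E1_def E2_def normalized_cov_def by blast
qed

end
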